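(* Let $G$ be a planar graph of girth at least $6$, and let $L$ be a list assignment for $G$ with $|L(v)|=2$ for every vertex $v\in V(G)$. Then there is an $L$-coloring of $G$ such that each monochromatic component is a path of length at most $14$.
   Context: A list assignment is a map $L: V(G)\to 2^{\mathbb{Z}}$; an $L$-coloring is a map $c: V(G)\to\mathbb{Z}$ with $c(v)\in L(v)$ for all $v$. The coloring need not be proper. A monochromatic component is a connected component of the subgraph induced by the vertices of a single color. The length of a path is its number of edges. The girth of a graph is the length of its shortest cycle (infinite if the graph has no cycle). *)

theory Defs
  imports "HOL-Analysis.Analysis" "HOL-Library.Extended_Nat"
begin

type_synonym 'a ugraph = "'a set \<times> 'a set set"

abbreviation verts :: "'a ugraph \<Rightarrow> 'a set" where
  "verts G \<equiv> fst G"

abbreviation edges :: "'a ugraph \<Rightarrow> 'a set set" where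
  "edges G \<equiv> snd G"

definition simple_graph :: "'a ugraph \<Rightarrow> bool" where
  "simple_graph G \<longleftrightarrow> finite (verts G) \<and> (\<forall>e\<in>edges G. e \<subseteq> verts G \<and> card e = 2)"

definition induced :: "'a ugraph \<Rightarrow> 'a set \<Rightarrow> 'a ugraph" where
  "induced G S = (verts G \<inter> S, {e \<in> edges G. e \<subseteq> S})"

definition walk :: "'a ugraph \<Rightarrow> 'a list \<Rightarrow> bool" where
  "walk G xs \<longleftrightarrow> xs \<noteq> [] \<and> set xs \<subseteq> verts G \<and>
     (\<forall>i. Suc i < length xs \<longrightarrow> {xs ! i, xs ! Suc i} \<in> edges G)"

definition reachable :: "'a ugraph \<Rightarrow> 'a \<Rightarrow> 'a \<Rightarrow> bool" where
  "reachable G u v \<longleftrightarrow> (\<exists>xs. walk G xs \<and> hd xs = u \<and> last xs = v)"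

definition graph_components :: "'a ugraph \<Rightarrow> 'a ugraph set" where
  "graph_components G = {induced G {v. reachable G u v} | u. u \<in> verts G}"

text \<open>A cycle is given by its distinct vertices in cyclic order, the first one not being
  repeated at the end, so the length of the list is the number of edges.\<close>

definition cycle :: "'a ugraph \<Rightarrow> 'a list \<Rightarrow> bool" where
  "cycle G xs \<longleftrightarrow> walk G xs \<and> distinct xs \<and> length xs \<ge> 3 \<and> {last xs, hd xs} \<in> edges G"

text \<open>For a graph without cycles this is the infimum of the empty set, i.e. \<open>\<infinity>\<close>.\<close>

definition girth :: "'a ugraph \<Rightarrow> enat" where
  "girth G = (INF xs\<in>{xs. cycle G xs}. enat (length xs))"

definition is_path_graph :: "'a ugraph \<Rightarrow> nat \<Rightarrow> bool" where
  "is_path_graph H n \<longleftrightarrow> (\<exists>xs. distinct xs \<and> length xs = Suc n \<and>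
     verts H = set xs \<and> edges H = {{xs ! i, xs ! Suc i} | i. i < n})"

text \<open>The plane is \<open>\<complex>\<close>. Vertices are drawn as distinct points and edges as simple arcs
  joining their end vertices; an arc contains no other vertex, and two arcs meet only in
  common end vertices.\<close>

definition plane_drawing ::
  "'a ugraph \<Rightarrow> ('a \<Rightarrow> complex) \<Rightarrow> ('a set \<Rightarrow> real \<Rightarrow> complex) \<Rightarrow> bool" where
  "plane_drawing G p \<gamma> \<longleftrightarrow>
     inj_on p (verts G) \<and>
     (\<forall>e\<in>edges G. arc (\<gamma> e) \<and> {pathstart (\<gamma> e), pathfinish (\<gamma> e)} = p ` e) \<and>
     (\<forall>e\<in>edges G. \<forall>v\<in>verts G. p v \<in> path_image (\<gamma> e) \<longrightarrow> v \<in> e) \<and>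
     (\<forall>e\<in>edges G. \<forall>f\<in>edges G. e \<noteq> f \<longrightarrow>
        path_image (\<gamma> e) \<inter> path_image (\<gamma> f) \<subseteq> p ` (e \<inter> f))"

definition planar_graph :: "'a ugraph \<Rightarrow> bool" where
  "planar_graph G \<longleftrightarrow> (\<exists>p \<gamma>. plane_drawing G p \<gamma>)"

definition list_coloring :: "'a ugraph \<Rightarrow> ('a \<Rightarrow> int set) \<Rightarrow> ('a \<Rightarrow> int) \<Rightarrow> bool" where
  "list_coloring G L c \<longleftrightarrow> (\<forall>v\<in>verts G. c v \<in> L v)"

definition monochromatic_components :: "'a ugraph \<Rightarrow> ('a \<Rightarrow> int) \<Rightarrow> 'a ugraph set" where
  "monochromatic_components G c = (\<Union>k. graph_components (induced G {v. c v = k}))"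

end

theory Submission imports Defs
begin

text \<open>By Euler's formula, a connected plane graph of girth at least 6 with \<open>n \<ge> 2\<close> vertices has at
  most \<open>(3 n - 4) / 2\<close> edges. We show that a graph all of whose connected induced subgraphs are that
  sparse has a spanning forest \<open>B\<close> (blue) such that every component of the remaining (red) edges
  has at most two edges; this is a case of the strong nine dragon tree theorem. A proper colouring
  of \<open>B\<close> from the lists then has only red monochromatic edges, so that the monochromatic
  components are in fact paths of length at most 2.

  For the decomposition, suppose that every choice of \<open>B\<close> leaves a red component with three or more
  edges. Orient the blue tree towards a root in such a component and explore the red components along
  blue edges. In an extremal choice of \<open>B\<close> and of the exploration, a component without
  edges is always entered from a component with at least two edges, and (with the
  exception of the root) no tree component leads to two of them: otherwise exchanging blue and red
  edges would improve the choice. Thus the explored components are too dense.\<close>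

section \<open>Connectivity by edge sets\<close>

text \<open>The density bound is a count. If \<open>H\<close> is the union of the explored
  components, the parent edge of every vertex of \<open>H\<close> but the root stays in
  \<open>H\<close>, so sparsity forces \<open>2 * s + 2 \<le> card H\<close> for the number
  \<open>s\<close> of explored red edges. A component with m edges has at most m + 1 vertices, which
  exceeds 2 m only for m = 0. So only components without edges are in surplus, by one vertex each,
  and the components from which they are entered have to pay for them. The obstacle: turning the
  blue edge to an isolated vertex red enlarges a red component, and a red edge must become blue in
  exchange. Enlarging is harmless up to one edge. Beyond that, two isolated vertices are attached at
  once and the component, a tree, is split between them: sides with a and b vertices become
  components with a and b edges instead of one with a + b - 1, and the cost is chosen so that this
  never costs more. The key is lexicographic because the red edge may have to come from an earlier
  component than the intended one; then the potential or an earlier size drops.\<close>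

definition con :: "'a set set \<Rightarrow> 'a \<Rightarrow> 'a \<Rightarrow> bool" where
  "con F u v \<longleftrightarrow> (u, v) \<in> {(a, b). {a, b} \<in> F}\<^sup>*"

lemma con_refl [simp]: "con F u u"
  by (simp add: con_def)

lemma con_trans: "con F u v \<Longrightarrow> con F v w \<Longrightarrow> con F u w"
  unfolding con_def by (rule rtrancl_trans)

lemma con_edge: "{u, v} \<in> F \<Longrightarrow> con F u v"
  unfolding con_def by auto

lemma con_sym: "con F u v \<Longrightarrow> con F v u"
proof -
  have "sym {(a, b). {a, b} \<in> F}"
    by (auto simp: sym_def insert_commute)
  then show "con F u v \<Longrightarrow> con F v u"
    unfolding con_def by (meson sym_rtrancl symD)
qed

lemma con_commute: "con F u v \<longleftrightarrow> con F v u"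
  using con_sym by metis

lemma con_mono: "con F u v \<Longrightarrow> F \<subseteq> F' \<Longrightarrow> con F' u v"
  unfolding con_def by (erule rev_subsetD, rule rtrancl_mono) auto

lemma con_induct [consumes 1, case_names refl step]:
  assumes "con F u v" "P u" "\<And>a b. con F u a \<Longrightarrow> {a, b} \<in> F \<Longrightarrow> P a \<Longrightarrow> P b"
  shows "P v"
  using assms(1) unfolding con_def
  by (induction rule: rtrancl_induct) (auto simp: assms(2) intro: assms(3) simp flip: con_def)

lemma con_subst:
  assumes "con F u v" "\<And>a b. {a, b} \<in> F \<Longrightarrow> con F' a b"
  shows "con F' u v"
  using assms(1) by (induction rule: con_induct) (auto intro: con_trans assms(2))

lemma con_insertD:
  assumes "con (insert {x, y} F) u v"
  shows "con F u v \<or> con F u x \<and> con F y v \<or> con F u y \<and> con F x v"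
  using assms
proof (induction rule: con_induct)
  case (step a b)
  show ?case
  proof (cases "{a, b} = {x, y}")
    case True
    then have "a = x \<and> b = y \<or> a = y \<and> b = x"
      by (auto simp: doubleton_eq_iff)
    with step show ?thesis by auto
  next
    case False
    with step have "con F a b" by (auto intro: con_edge)
    with step show ?thesis by (meson con_trans)
  qed
qed auto

lemma con_removeD:
  assumes "con F u v"
  shows "con (F - {{x, y}}) u v \<or> con (F - {{x, y}}) u x \<and> con (F - {{x, y}}) y v
    \<or> con (F - {{x, y}}) u y \<and> con (F - {{x, y}}) x v"
  by (rule con_insertD, rule con_mono[OF assms]) auto

lemma con_cross:
  assumes "con F u v" "u \<in> Q" "v \<notin> Q"
  shows "\<exists>a b. {a, b} \<in> F \<and> a \<in> Q \<and> b \<notin> Q"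
proof (rule ccontr)
  assume "\<not> ?thesis"
  then have step: "\<And>a b. {a, b} \<in> F \<Longrightarrow> a \<in> Q \<Longrightarrow> b \<in> Q" by auto
  have "v \<in> Q"
    using assms(1) by (induction rule: con_induct) (use assms(2) step in auto)
  with assms(3) show False by simp
qed

text \<open>A crossing edge as such may be irrelevant for joining \<open>x\<close> to
  \<open>z\<close>. Edges whose removal keeps \<open>x\<close> and \<open>z\<close> connected are
  therefore discarded first; once none is left, every crossing edge lies on all paths from
  \<open>x\<close> to \<open>z\<close>.\<close>

lemma con_cross_essential:
  assumes "finite F" "con F x z" "x \<in> Q" "z \<notin> Q"
  shows "\<exists>c d. {c, d} \<in> F \<and> con (F - {{c, d}}) x c \<and> con (F - {{c, d}}) d z \<and> (c \<in> Q \<longleftrightarrow> d \<notin> Q)"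
  using assms
proof (induction F rule: finite_psubset_induct)
  case (psubset F)
  show ?case
  proof (cases "\<exists>g\<in>F. con (F - {g}) x z")
    case True
    then obtain g where g: "g \<in> F" "con (F - {g}) x z" by auto
    with psubset.prems psubset.IH[of "F - {g}"] have "\<exists>c d. {c, d} \<in> F - {g} \<and>
        con (F - {g} - {{c, d}}) x c \<and> con (F - {g} - {{c, d}}) d z \<and> (c \<in> Q \<longleftrightarrow> d \<notin> Q)"
      by blast
    then obtain c d where cd:
      "{c, d} \<in> F - {g}" "con (F - {g} - {{c, d}}) x c" "con (F - {g} - {{c, d}}) d z" "c \<in> Q \<longleftrightarrow> d \<notin> Q"
      by blast
    have "F - {g} - {{c, d}} \<subseteq> F - {{c, d}}" by auto
    with cd(2,3) have "con (F - {{c, d}}) x c" "con (F - {{c, d}}) d z"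
      by (auto elim: con_mono)
    with cd(1,4) show ?thesis by blast
  next
    case False
    obtain a b where ab: "{a, b} \<in> F" "a \<in> Q" "b \<notin> Q"
      using con_cross[OF psubset.prems] by auto
    with False have "\<not> con (F - {{a, b}}) x z" by auto
    with con_removeD[OF psubset.prems(1), of a b] ab show ?thesis
    proof (elim disjE)
      assume "con (F - {{a, b}}) x b \<and> con (F - {{a, b}}) a z"
      then show ?thesis
        using ab by (intro exI[of _ b] exI[of _ a]) (auto simp: insert_commute)
    qed (use ab in auto)
  qed
qed

definition conn_comp :: "'a set set \<Rightarrow> 'a \<Rightarrow> 'a set" where
  "conn_comp F v = {u. con F v u}"

definition comp_edges :: "'a set set \<Rightarrow> 'a \<Rightarrow> 'a set set" where
  "comp_edges F v = {f\<in>F. f \<subseteq> conn_comp F v}"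

definition comp_size :: "'a set set \<Rightarrow> 'a \<Rightarrow> nat" where
  "comp_size F v = card (comp_edges F v)"

lemma self_in_comp [simp]: "v \<in> conn_comp F v"
  by (simp add: conn_comp_def)

lemma comp_eq: "u \<in> conn_comp F v \<Longrightarrow> conn_comp F u = conn_comp F v"
  unfolding conn_comp_def using con_sym con_trans by fast

lemma comp_disjoint: "u \<notin> conn_comp F v \<Longrightarrow> conn_comp F u \<inter> conn_comp F v = {}"
  unfolding conn_comp_def using con_sym con_trans by fast

lemma comp_size_eq: "u \<in> conn_comp F v \<Longrightarrow> comp_size F u = comp_size F v"
  unfolding comp_size_def comp_edges_def using comp_eq by metis

lemma comp_step: "{a, b} \<in> F \<Longrightarrow> a \<in> conn_comp F v \<longleftrightarrow> b \<in> conn_comp F v"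
  unfolding conn_comp_def by (metis con_edge con_trans insert_commute mem_Collect_eq)

lemma comp_least:
  assumes "v \<in> X" "\<And>a b. {a, b} \<in> F \<Longrightarrow> a \<in> X \<Longrightarrow> b \<in> X"
  shows "conn_comp F v \<subseteq> X"
proof
  fix u assume "u \<in> conn_comp F v"
  then have "con F v u" by (simp add: conn_comp_def)
  then show "u \<in> X" by (induction rule: con_induct) (use assms in auto)
qed

lemma con_in_comp_edges: "u \<in> conn_comp F v \<Longrightarrow> con (comp_edges F v) v u"
proof -
  assume "u \<in> conn_comp F v"
  then have "con F v u" by (simp add: conn_comp_def)
  then show ?thesis
  proof (induction rule: con_induct)
    case (step a b)
    then have "{a, b} \<in> comp_edges F v"
      by (auto simp: comp_edges_def conn_comp_def intro: con_trans con_edge)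
    with step show ?case by (meson con_edge con_trans)
  qed simp
qed

lemma con_within_comp_edges: "u \<in> conn_comp F v \<Longrightarrow> w \<in> conn_comp F v \<Longrightarrow> con (comp_edges F v) u w"
  using con_in_comp_edges con_sym con_trans by metis

text \<open>A tree is grown inside \<open>X\<close> from one vertex: as long as vertices are
  missing, some edge leaves the part reached so far and brings exactly one new vertex.\<close>

lemma card_le_edges:
  assumes "finite F" "finite X" "X \<noteq> {}" "\<And>u v. u \<in> X \<Longrightarrow> v \<in> X \<Longrightarrow> con F u v"
    "\<And>f. f \<in> F \<Longrightarrow> f \<subseteq> X"
  shows "card X \<le> card F + 1"
proof -
  obtain v where v: "v \<in> X" using assms(3) by auto
  have "\<exists>A F'. A \<subseteq> X \<and> v \<in> A \<and> F' \<subseteq> F \<and> (\<forall>f\<in>F'. f \<subseteq> A) \<and> card A = Suc n \<and> card F' = n"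
    if "Suc n \<le> card X" for n
    using that
  proof (induction n)
    case 0
    show ?case using v by (intro exI[of _ "{v}"] exI[of _ "{}"]) auto
  next
    case (Suc n)
    then obtain A F' where A: "A \<subseteq> X" "v \<in> A" "F' \<subseteq> F" "\<forall>f\<in>F'. f \<subseteq> A" "card A = Suc n" "card F' = n"
      by (meson Suc_leD)
    with Suc.prems have "A \<noteq> X" by (metis Suc_n_not_le_n)
    with A(1) obtain u where u: "u \<in> X" "u \<notin> A" by auto
    from con_cross[OF assms(4)[OF v u(1)] A(2) u(2)]
    obtain a b where ab: "{a, b} \<in> F" "a \<in> A" "b \<notin> A"
      by blast
    have fin: "finite A" "finite F'"
      using A(1,3) assms(1,2) finite_subset by blast+
    have "{a, b} \<notin> F'" using A(4) ab by auto
    then have "card (insert {a, b} F') = Suc n" "card (insert b A) = Suc (Suc n)"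
      using A(5,6) ab(3) fin by auto
    moreover have "b \<in> X" using assms(5) ab by auto
    ultimately show ?case
      using A(1-4) ab by (intro exI[of _ "insert b A"] exI[of _ "insert {a, b} F'"]) auto
  qed
  note * = this
  have "Suc (card X - 1) = card X"
    using assms(2,3) by (simp add: card_gt_0_iff)
  with *[of "card X - 1"] obtain F' where "F' \<subseteq> F" "card F' = card X - 1"
    by auto
  with card_mono[OF assms(1), of F'] show ?thesis by linarith
qed

lemma finite_ec [simp]: "finite F \<Longrightarrow> finite (comp_edges F v)"
  by (simp add: comp_edges_def)

lemma card_comp_le:
  assumes "finite F" "finite (conn_comp F v)"
  shows "card (conn_comp F v) \<le> comp_size F v + 1"
  unfolding comp_size_def
proof (rule card_le_edges)
  show "finite (comp_edges F v)" using assms(1) by simp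
  show "con (comp_edges F v) u w" if "u \<in> conn_comp F v" "w \<in> conn_comp F v" for u w
    using that by (rule con_within_comp_edges)
  show "f \<subseteq> conn_comp F v" if "f \<in> comp_edges F v" for f
    using that by (simp add: comp_edges_def)
  show "conn_comp F v \<noteq> {}" using self_in_comp[of v F] by blast
qed fact

text \<open>A new edge enters a component only by meeting it. The empty edge is excluded because it
  is contained in every component without meeting any.\<close>

lemma comp_edges_mono_gen:
  assumes "F' \<subseteq> F \<union> A" "\<And>f. f \<in> A \<Longrightarrow> f \<inter> conn_comp F v = {}" "{} \<notin> F'"
  shows "conn_comp F' v \<subseteq> conn_comp F v" "comp_edges F' v \<subseteq> comp_edges F v \<inter> F'"
proof -
  show *: "conn_comp F' v \<subseteq> conn_comp F v"
  proof (rule comp_least)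
    fix a b assume ab: "{a, b} \<in> F'" "a \<in> conn_comp F v"
    with assms have "{a, b} \<in> F" by auto
    with ab show "b \<in> conn_comp F v" using comp_step by metis
  qed simp
  show "comp_edges F' v \<subseteq> comp_edges F v \<inter> F'"
  proof
    fix f assume "f \<in> comp_edges F' v"
    then have f: "f \<in> F'" "f \<subseteq> conn_comp F' v" by (auto simp: comp_edges_def)
    moreover have "f \<noteq> {}" using f assms(3) by auto
    moreover have "f \<subseteq> conn_comp F v" using f(2) * by (rule subset_trans)
    ultimately have "f \<inter> conn_comp F v \<noteq> {}" by (simp add: Int_absorb2)
    then have "f \<notin> A" using assms(2) by blast
    with f(1) assms(1) have "f \<in> F" by auto
    with f * show "f \<in> comp_edges F v \<inter> F'" by (auto simp: comp_edges_def)
  qed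
qed

section \<open>Spanning forests\<close>

lemma ex_least_index: "P (k::nat) \<Longrightarrow> \<exists>j\<le>k. P j \<and> (\<forall>i<j. \<not> P i)"
  by (intro exI[of _ "LEAST j. P j"]) (auto intro: LeastI Least_le dest: not_less_Least)

text \<open>Monotonicity is applied in both directions: the first gives that the component under
  \<open>F'\<close> is no larger, so the exchanged edges miss it as well.\<close>

lemma comp_edges_agree:
  assumes "\<And>f. f \<in> (F - F') \<union> (F' - F) \<Longrightarrow> f \<inter> conn_comp F v = {}" "{} \<notin> F" "{} \<notin> F'"
  shows "conn_comp F' v = conn_comp F v" "comp_edges F' v = comp_edges F v"
proof -
  have 1: "conn_comp F' v \<subseteq> conn_comp F v" "comp_edges F' v \<subseteq> comp_edges F v \<inter> F'"
    by (rule comp_edges_mono_gen[of F' F "F' - F"]; use assms in blast)+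
  have 2: "conn_comp F v \<subseteq> conn_comp F' v" "comp_edges F v \<subseteq> comp_edges F' v \<inter> F"
    by (rule comp_edges_mono_gen[of F F' "F - F'"]; use assms 1 in blast)+
  show "conn_comp F' v = conn_comp F v" "comp_edges F' v = comp_edges F v" using 1 2 by auto
qed

locale finite_graph =
  fixes V :: "'a set" and E :: "'a set set"
  assumes finV: "finite V"
    and edge: "\<And>e. e \<in> E \<Longrightarrow> e \<subseteq> V \<and> card e = 2"
begin

lemma finE: "finite E"
  using finV edge by (meson Pow_iff finite_Pow_iff finite_subset subsetI)

lemma edgeD: "{u, v} \<in> E \<Longrightarrow> u \<in> V \<and> v \<in> V \<and> u \<noteq> v"
  using edge[of "{u, v}"] by (auto simp: card_insert_if split: if_splits)

lemma empty_notin: "F \<subseteq> E \<Longrightarrow> {} \<notin> F"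
  using edge by fastforce

lemma edge_obtain: "e \<in> E \<Longrightarrow> \<exists>u v. e = {u, v} \<and> u \<noteq> v"
  using edge card_2_iff by metis

lemma con_in_V: "con F r v \<Longrightarrow> F \<subseteq> E \<Longrightarrow> r \<in> V \<Longrightarrow> v \<in> V"
  by (induction rule: con_induct) (use edgeD in auto)

lemma comp_size_mono: "F \<subseteq> F' \<Longrightarrow> F' \<subseteq> E \<Longrightarrow> comp_size F v \<le> comp_size F' v"
proof -
  assume F: "F \<subseteq> F'" "F' \<subseteq> E"
  have "comp_edges F v \<subseteq> comp_edges F' v \<inter> F"
    by (rule comp_edges_mono_gen[of F F' "{}"]) (use F empty_notin in auto)
  moreover have "finite (comp_edges F' v)" using F finE finite_subset finite_ec by metis
  ultimately show ?thesis unfolding comp_size_def by (auto intro: card_mono)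
qed

definition spanning :: "'a set set \<Rightarrow> bool" where
  "spanning B \<longleftrightarrow> B \<subseteq> E \<and> (\<forall>u v. con E u v \<longrightarrow> con B u v)"

text \<open>Being a forest is expressed by minimality of the number of edges, which an exchange of edges
  visibly preserves.\<close>

definition span_forest :: "'a set set \<Rightarrow> bool" where
  "span_forest B \<longleftrightarrow> spanning B \<and> (\<forall>B'. spanning B' \<longrightarrow> card B \<le> card B')"

lemma ex_span_forest: "\<exists>B. span_forest B"
proof -
  have "spanning E" by (simp add: spanning_def)
  then show ?thesis unfolding span_forest_def
    using ex_has_least_nat[of spanning E card] by auto
qed

lemma span_forest_sub: "span_forest B \<Longrightarrow> B \<subseteq> E"
  by (simp add: span_forest_def spanning_def)

lemma span_forest_con: "span_forest B \<Longrightarrow> con B u v \<longleftrightarrow> con E u v"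
  unfolding span_forest_def spanning_def using con_mono by metis

text \<open>Acyclicity is recovered here from minimality: dropping an edge whose ends stay connected
  would leave a smaller spanning set.\<close>

lemma span_forest_bridge:
  assumes "span_forest B" "{x, y} \<in> B"
  shows "\<not> con (B - {{x, y}}) x y"
proof
  assume *: "con (B - {{x, y}}) x y"
  have "con (B - {{x, y}}) u v" if "con E u v" for u v
  proof (rule con_subst)
    show "con B u v" using that span_forest_con assms by auto
    fix a b assume "{a, b} \<in> B"
    then show "con (B - {{x, y}}) a b"
      using * by (cases "{a, b} = {x, y}") (auto simp: doubleton_eq_iff intro: con_edge con_sym)
  qed
  then have "spanning (B - {{x, y}})"
    using span_forest_sub[OF assms(1)] by (auto simp: spanning_def)
  then have "card B \<le> card (B - {{x, y}})" using assms by (auto simp: span_forest_def)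
  moreover have "finite B" using span_forest_sub[OF assms(1)] finE finite_subset by auto
  ultimately show False using assms(2) by (metis card_Diff1_less not_le)
qed

lemma span_forest_exchange:
  assumes "span_forest B" "B' \<subseteq> E" "card B' \<le> card B" "\<And>a b. {a, b} \<in> B \<Longrightarrow> con B' a b"
  shows "span_forest B'"
proof -
  have "spanning B'"
    unfolding spanning_def using assms(2) con_subst[of B _ _ B', OF _ assms(4)] span_forest_con[OF assms(1)]
    by auto
  then show ?thesis using assms(1,3) unfolding span_forest_def by (meson order_trans)
qed

text \<open>When the tree of \<open>B\<close> containing \<open>r\<close> is rooted at \<open>r\<close>, the parent of \<open>x\<close> is \<open>y\<close>.\<close>

definition parent :: "'a set set \<Rightarrow> 'a \<Rightarrow> 'a \<Rightarrow> 'a \<Rightarrow> bool" where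
  "parent B r x y \<longleftrightarrow> {x, y} \<in> B \<and> con E r x \<and> \<not> con (B - {{x, y}}) x r"

lemma parent_head:
  assumes "span_forest B" "parent B r x y"
  shows "con (B - {{x, y}}) y r"
proof -
  have "con B x r" using assms span_forest_con con_sym unfolding parent_def by metis
  from con_removeD[OF this, of x y] show ?thesis using assms(2) by (auto simp: parent_def)
qed

lemma parent_con: "span_forest B \<Longrightarrow> parent B r x y \<Longrightarrow> con E r y"
  using parent_head con_sym con_mono span_forest_sub Diff_subset by (metis order_trans)

lemma parent_edge: "span_forest B \<Longrightarrow> parent B r x y \<Longrightarrow> {x, y} \<in> B \<and> {x, y} \<in> E \<and> x \<noteq> y"
  using span_forest_sub edgeD unfolding parent_def by blast

lemma no_parent_root: "\<not> parent B r r y"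
  by (simp add: parent_def)

lemma parent_antisym: "span_forest B \<Longrightarrow> parent B r x y \<Longrightarrow> \<not> parent B r y x"
  using parent_head[of B r x y] unfolding parent_def by (simp add: insert_commute)

text \<open>After deleting both edges, \<open>x\<close>, \<open>y\<close> or \<open>z\<close> still
  reaches \<open>r\<close>. A path from \<open>y\<close> or \<open>z\<close> can be prolonged to
  \<open>x\<close> by the edge between them, so in each case \<open>x\<close> reaches
  \<open>r\<close> while avoiding one of its two parent edges.\<close>

lemma parent_unique:
  assumes "span_forest B" "parent B r x y" "parent B r x z"
  shows "y = z"
proof (rule ccontr)
  assume "y \<noteq> z"
  let ?B = "B - {{x, y}} - {{x, z}}"
  have sub: "?B \<subseteq> B - {{x, y}}" "?B \<subseteq> B - {{x, z}}" by auto
  have ne: "{x, y} \<noteq> {x, z}" using \<open>y \<noteq> z\<close> by (auto simp: doubleton_eq_iff)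
  from con_removeD[OF parent_head[OF assms(1,2)], of x z]
  have "con ?B y r \<or> con ?B x r \<or> con ?B z r" by auto
  moreover have "\<not> con ?B x r"
    using con_mono[OF _ sub(1)] assms(2) by (auto simp: parent_def)
  moreover have "\<not> con ?B y r"
    using con_trans[of "B - {{x, z}}" x y r] con_mono[of ?B y r, OF _ sub(2)] assms(2,3) ne
    by (auto simp: parent_def intro: con_edge)
  moreover have "\<not> con ?B z r"
    using con_trans[of "B - {{x, y}}" x z r] con_mono[of ?B z r, OF _ sub(1)] assms(2,3) ne
    by (auto simp: parent_def intro: con_edge)
  ultimately show False by blast
qed

text \<open>The edge leaving \<open>{v}\<close> on a path to \<open>r\<close> is the parent edge. It
  cannot be traversed towards \<open>v\<close>, since its other end would then be reachable from
  \<open>v\<close> without it.\<close>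

lemma ex_parent:
  assumes "span_forest B" "con E r v" "v \<noteq> r"
  shows "\<exists>y. parent B r v y"
proof -
  have fin: "finite B" using span_forest_sub[OF assms(1)] finE finite_subset by auto
  have "con B v r" using assms span_forest_con con_sym by metis
  from con_cross_essential[OF fin this, of "{v}"] assms(3)
  obtain c d where cd: "{c, d} \<in> B" "con (B - {{c, d}}) v c" "con (B - {{c, d}}) d r" "c = v \<longleftrightarrow> d \<noteq> v"
    by auto
  have "c = v"
  proof (rule ccontr)
    assume "c \<noteq> v"
    then have "d = v" using cd by auto
    then show False using span_forest_bridge[OF assms(1) cd(1)] cd con_sym by metis
  qed
  moreover have "\<not> con (B - {{c, d}}) v r"
    using span_forest_bridge[OF assms(1) cd(1)] cd con_sym con_trans calculation by metis
  ultimately show ?thesis using cd assms unfolding parent_def by auto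
qed

text \<open>\<open>B0\<close> is the part of the forest common to both sides of an exchange. Paths
  in a forest are unique, so if \<open>u\<close> reaches \<open>r\<close> inside \<open>B0\<close>,
  that path starts with the parent edge, which therefore survives.\<close>

lemma parent_preserve:
  assumes "span_forest B" "span_forest B'" "B0 \<subseteq> B" "B0 \<subseteq> B'" "parent B r u w" "con B0 u r"
  shows "parent B' r u w" "con B0 w r"
proof -
  have uw: "{u, w} \<in> B0"
  proof (rule ccontr)
    assume "{u, w} \<notin> B0"
    then have "B0 \<subseteq> B - {{u, w}}" using assms by auto
    then show False using assms(5,6) con_mono unfolding parent_def by metis
  qed
  have "B0 - {{u, w}} \<subseteq> B - {{u, w}}" using assms by auto
  with assms(5) have "\<not> con (B0 - {{u, w}}) u r" unfolding parent_def by (auto dest: con_mono)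
  with con_removeD[OF assms(6), of u w] have w: "con (B0 - {{u, w}}) w r" by auto
  then show "con B0 w r" by (rule con_mono) auto
  have "B0 - {{u, w}} \<subseteq> B' - {{u, w}}" using assms by auto
  with w have w': "con (B' - {{u, w}}) w r" by (rule con_mono)
  have in': "{u, w} \<in> B'" using uw assms by auto
  have "\<not> con (B' - {{u, w}}) u r"
  proof
    assume "con (B' - {{u, w}}) u r"
    then have "con (B' - {{u, w}}) u w" by (rule con_trans[OF _ con_sym[OF w']])
    then show False using span_forest_bridge[OF assms(2) in'] by simp
  qed
  then show "parent B' r u w" using in' assms(5) unfolding parent_def by auto
qed

text \<open>Every edge of \<open>B\<close> is charged to its lower end, whose parent is unique and
  which is never the root.\<close>

lemma card_span_forest:
  assumes "span_forest B" "r \<in> V" "\<And>v. v \<in> V \<Longrightarrow> con E r v"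
  shows "card B + 1 \<le> card V"
proof -
  have BE: "B \<subseteq> E" using span_forest_sub[OF assms(1)] .
  have "\<exists>x y. e = {x, y} \<and> parent B r x y" if e: "e \<in> B" for e
  proof -
    obtain x y where xy: "e = {x, y}" using edge_obtain e BE by blast
    have V: "x \<in> V" "y \<in> V" using edgeD[of x y] e xy BE by auto
    have e': "{x, y} \<in> B" "{y, x} \<in> B" using e xy by (auto simp: insert_commute)
    show ?thesis
    proof (cases "con (B - {{x, y}}) x r")
      case True
      have "\<not> con (B - {{x, y}}) y r"
      proof
        assume "con (B - {{x, y}}) y r"
        from con_trans[OF True con_sym[OF this]] show False
          using span_forest_bridge[OF assms(1) e'(1)] by simp
      qed
      then have "parent B r y x"
        unfolding parent_def using e'(2) assms(3)[OF V(2)] insert_commute[of y x "{}"] by simp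
      moreover have "e = {y, x}" using xy by (simp add: insert_commute)
      ultimately show ?thesis by blast
    next
      case False
      then have "parent B r x y" unfolding parent_def using e'(1) assms(3)[OF V(1)] by simp
      then show ?thesis using xy by blast
    qed
  qed
  then have "\<forall>e\<in>B. \<exists>x. \<exists>y. e = {x, y} \<and> parent B r x y" by blast
  then obtain x where x: "\<forall>e\<in>B. \<exists>y. e = {x e, y} \<and> parent B r (x e) y"
    by (rule bchoice[THEN exE])
  have "card B \<le> card (V - {r})"
  proof (rule card_inj_on_le)
    show "inj_on x B"
    proof (rule inj_onI)
      fix e f assume ef: "e \<in> B" "f \<in> B" "x e = x f"
      obtain y where y: "e = {x e, y}" "parent B r (x e) y" using x ef(1) by blast
      obtain z where z: "f = {x f, z}" "parent B r (x f) z" using x ef(2) by blast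
      have "y = z" by (rule parent_unique[OF assms(1) y(2)]) (use z(2) ef(3) in simp)
      then show "e = f" using y(1) z(1) ef(3) by simp
    qed
    show "x ` B \<subseteq> V - {r}"
    proof
      fix v assume "v \<in> x ` B"
      then obtain e where e: "e \<in> B" "v = x e" by auto
      then obtain y where "parent B r v y" using x by blast
      then have "v \<noteq> r" "{v, y} \<in> E" using no_parent_root parent_edge[OF assms(1)] by auto
      then show "v \<in> V - {r}" using edgeD by blast
    qed
  qed (use finV in simp)
  moreover have "card V > 0" using assms(2) finV card_gt_0_iff by blast
  ultimately show ?thesis using assms(2) finV by simp
qed

end

section \<open>Extremal decompositions\<close>

lemma lexn_lessI:
  assumes "(a::nat) < b" "length (p @ a # s) = n" "length (p @ b # t) = n"
  shows "(p @ a # s, p @ b # t) \<in> lexn less_than n"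
  unfolding lexn_conv using assms by auto

context finite_graph
begin

definition weight :: "nat \<Rightarrow> nat" where
  "weight n = (if n \<le> 2 then 0 else n)"

text \<open>Summing over vertices charges a component with at least three edges the product of its
  numbers of vertices and edges. This grows faster than linearly, so that splitting a large
  component pays.\<close>

definition potential :: "'a set set \<Rightarrow> nat" where
  "potential R = (\<Sum>v\<in>V. weight (comp_size R v))"

lemma weight_mono: "m \<le> n \<Longrightarrow> weight m \<le> weight n"
  by (simp add: weight_def)

lemma weight_strict: "m < n \<Longrightarrow> 3 \<le> n \<Longrightarrow> weight m < weight n"
  by (simp add: weight_def)

lemma potential_mono: "(\<And>v. v \<in> V \<Longrightarrow> weight (comp_size R' v) \<le> weight (comp_size R v)) \<Longrightarrow> potential R' \<le> potential R"
  unfolding potential_def by (rule sum_mono)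

lemma potential_strict:
  assumes "\<And>v. v \<in> V \<Longrightarrow> weight (comp_size R' v) \<le> weight (comp_size R v)" "u \<in> V" "comp_size R' u < comp_size R u" "3 \<le> comp_size R u"
  shows "potential R' < potential R"
  unfolding potential_def by (rule sum_strict_mono_ex1) (use assms finV weight_strict in auto)

text \<open>The list contains one entry vertex for each explored red component.\<close>

definition legal :: "'a set set \<Rightarrow> 'a list \<Rightarrow> bool" where
  "legal B ys \<longleftrightarrow> ys \<noteq> [] \<and>
    (\<forall>i<length ys. 0 < i \<longrightarrow> (\<exists>j<i. \<exists>x. con (E - B) (ys ! j) x \<and> parent B (hd ys) x (ys ! i))) \<and>
    (\<forall>i<length ys. \<forall>j<i. \<not> con (E - B) (ys ! j) (ys ! i))"

definition state :: "'a set set \<Rightarrow> 'a list \<Rightarrow> bool" where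
  "state B ys \<longleftrightarrow> span_forest B \<and> legal B ys \<and> 3 \<le> comp_size (E - B) (hd ys)"

text \<open>The padding exceeds every component size, so that extending an exploration makes its key
  lexicographically smaller.\<close>

definition key :: "'a set set \<Rightarrow> 'a list \<Rightarrow> nat list" where
  "key B ys = potential (E - B) # map (comp_size (E - B)) (tl ys)
     @ replicate (card V - length ys) (Suc (card E))"

definition minstate :: "'a set set \<Rightarrow> 'a list \<Rightarrow> bool" where
  "minstate B ys \<longleftrightarrow> state B ys \<and>
     (\<forall>B' ys'. state B' ys' \<longrightarrow> (key B' ys', key B ys) \<notin> lexn less_than (card V))"

lemma ex_minstate: "state B ys \<Longrightarrow> \<exists>B ys. minstate B ys"
proof -
  assume s: "state B ys"
  have "wf (inv_image (lexn less_than (card V)) (\<lambda>(B, ys). key B ys))"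
    by (intro wf_inv_image wf_lexn wf_less_than)
  from wfE_min[OF this, of "(B, ys)" "{(B, ys). state B ys}"] s
  obtain z where "z \<in> {(B, ys). state B ys}"
    "\<And>y. (y, z) \<in> inv_image (lexn less_than (card V)) (\<lambda>(B, ys). key B ys) \<Longrightarrow> y \<notin> {(B, ys). state B ys}"
    by auto
  then have "minstate (fst z) (snd z)"
    unfolding minstate_def by (auto simp: case_prod_beta)
  then show ?thesis by blast
qed

lemma legal_con:
  assumes "span_forest B" "legal B ys" "i < length ys"
  shows "con E (hd ys) (ys ! i)"
proof (cases "i = 0")
  case True
  then show ?thesis using assms by (simp add: legal_def hd_conv_nth)
next
  case False
  then show ?thesis using assms parent_con unfolding legal_def by blast
qed

lemma bad_in_V:
  assumes "3 \<le> comp_size R v" "R \<subseteq> E"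
  shows "v \<in> V"
proof -
  have "comp_edges R v \<noteq> {}" using assms(1) unfolding comp_size_def by (metis card.empty not_numeral_le_zero)
  then obtain f where f: "f \<in> R" "f \<subseteq> conn_comp R v" unfolding comp_edges_def by auto
  then obtain a b where "f = {a, b}" using assms edge_obtain by blast
  with f have "con R v a" by (simp add: conn_comp_def)
  moreover have "a \<in> V" using f(1) \<open>f = {a, b}\<close> assms(2) edgeD by auto
  ultimately show ?thesis using con_in_V[OF con_sym assms(2)] by auto
qed

lemma legal_length:
  assumes "span_forest B" "legal B ys" "3 \<le> comp_size (E - B) (hd ys)"
  shows "length ys \<le> card V"
proof -
  have "set ys \<subseteq> V"
    using con_in_V[OF legal_con[OF assms(1,2)]] bad_in_V[OF assms(3)] by (auto simp: in_set_conv_nth)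
  moreover have "distinct ys"
    using assms(2) unfolding legal_def distinct_conv_nth by (metis con_refl linorder_neqE_nat)
  ultimately show ?thesis using finV by (metis card_mono distinct_card)
qed

lemma length_key: "span_forest B \<Longrightarrow> legal B ys \<Longrightarrow> 3 \<le> comp_size (E - B) (hd ys) \<Longrightarrow> length (key B ys) = card V"
  using legal_length[of B ys] by (auto simp: key_def legal_def Suc_diff_le simp flip: length_greater_0_conv)

text \<open>The one-vertex exploration \<open>[v]\<close> turns any competing forest with a large
  component into a state, whatever its root, and the potential is the leading entry of the
  key.\<close>

lemma min_potential:
  assumes "minstate B ys" "span_forest B'" "3 \<le> comp_size (E - B') v"
  shows "potential (E - B) \<le> potential (E - B')"
proof (rule ccontr)
  assume "\<not> ?thesis"
  moreover have st: "state B' [v]" using assms by (simp add: state_def legal_def)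
  ultimately have "(key B' [v], key B ys) \<in> lexn less_than (card V)"
    using length_key[of B ys] length_key[of B' "[v]"] assms(1)
    unfolding key_def by (intro lexn_lessI[where p = "[]", simplified]) (auto simp: minstate_def state_def)
  then show False using st assms(1) unfolding minstate_def by auto
qed

text \<open>Otherwise \<open>y\<close> could be appended, which replaces the first padding entry of
  the key by a genuine, hence smaller, component size. A padding entry is available because no legal
  exploration is longer than \<open>card V\<close>.\<close>

lemma min_closed:
  assumes "minstate B ys" "i < length ys" "con (E - B) (ys ! i) x" "parent B (hd ys) x y"
  shows "\<exists>j<length ys. con (E - B) (ys ! j) y"
proof (rule ccontr)
  assume no: "\<not> ?thesis"
  have st: "span_forest B" "legal B ys" "3 \<le> comp_size (E - B) (hd ys)" "ys \<noteq> []"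
    using assms(1) by (auto simp: minstate_def state_def legal_def)
  have leg: "legal B (ys @ [y])"
    unfolding legal_def
  proof (intro conjI allI impI)
    fix k assume k: "k < length (ys @ [y])"
    show "\<exists>j<k. \<exists>x. con (E - B) ((ys @ [y]) ! j) x \<and> parent B (hd (ys @ [y])) x ((ys @ [y]) ! k)" if "0 < k"
    proof (cases "k = length ys")
      case True
      then show ?thesis using assms st by (intro exI[of _ i] conjI exI[of _ x]) (auto simp: nth_append)
    next
      case False
      with k have "k < length ys" by auto
      with st(2) that obtain j x where "j < k" "con (E - B) (ys ! j) x" "parent B (hd ys) x (ys ! k)"
        unfolding legal_def by blast
      then show ?thesis using \<open>k < length ys\<close> st
        by (intro exI[of _ j] conjI exI[of _ x]) (auto simp: nth_append)
    qed
    show "\<not> con (E - B) ((ys @ [y]) ! j) ((ys @ [y]) ! k)" if "j < k" for j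
      using no k that st(2) unfolding legal_def by (cases "k = length ys") (auto simp: nth_append)
  qed simp
  have len: "length (ys @ [y]) \<le> card V"
    using legal_length[OF st(1) leg] st by simp
  then have rep: "replicate (card V - length ys) (Suc (card E)) =
      Suc (card E) # replicate (card V - length (ys @ [y])) (Suc (card E))"
    by (cases "card V - length ys") auto
  have "comp_size (E - B) y \<le> card E"
    unfolding comp_size_def comp_edges_def by (rule card_mono[OF finE]) auto
  then have "((potential (E - B) # map (comp_size (E - B)) (tl ys)) @ comp_size (E - B) y # replicate (card V - length (ys @ [y])) (Suc (card E)),
     (potential (E - B) # map (comp_size (E - B)) (tl ys)) @ Suc (card E) # replicate (card V - length (ys @ [y])) (Suc (card E)))
     \<in> lexn less_than (card V)"
    by (rule lexn_lessI[OF le_imp_less_Suc]) (use len st in \<open>cases ys; simp\<close>)+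
  moreover have "key B (ys @ [y]) = (potential (E - B) # map (comp_size (E - B)) (tl ys)) @ comp_size (E - B) y #
      replicate (card V - length (ys @ [y])) (Suc (card E))"
    unfolding key_def using st by simp
  moreover have "key B ys = (potential (E - B) # map (comp_size (E - B)) (tl ys)) @ Suc (card E) #
      replicate (card V - length (ys @ [y])) (Suc (card E))"
    unfolding key_def rep by simp
  moreover have "state B (ys @ [y])" using st leg by (simp add: state_def)
  ultimately show False using assms(1) unfolding minstate_def by metis
qed

text \<open>A changed forest need only preserve the exploration up to \<open>j\<close>: if entry
  \<open>j\<close> drops while everything before it is equal, the key drops whatever follows. The
  potentials are equal since \<open>min_potential\<close> excludes a smaller one.\<close>

lemma min_step:
  assumes "minstate B ys" "state B' (take (Suc j) ys)" "0 < j" "j < length ys"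
    "potential (E - B') \<le> potential (E - B)" "\<And>i. i < j \<Longrightarrow> comp_size (E - B') (ys ! i) = comp_size (E - B) (ys ! i)"
  shows "comp_size (E - B) (ys ! j) \<le> comp_size (E - B') (ys ! j)"
proof (rule ccontr)
  assume no: "\<not> ?thesis"
  have st: "span_forest B" "legal B ys" "3 \<le> comp_size (E - B) (hd ys)" "ys \<noteq> []"
    and st': "span_forest B'" "legal B' (take (Suc j) ys)" "3 \<le> comp_size (E - B') (hd (take (Suc j) ys))"
    using assms(1,2) by (auto simp: minstate_def state_def legal_def)
  have potential: "potential (E - B') = potential (E - B)"
    using assms(5) min_potential[OF assms(1) st'(1,3)] by simp
  have j: "j - 1 < length (tl ys)" "tl ys ! (j - 1) = ys ! j" using assms(3,4) by (auto simp: nth_tl)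
  have tl1: "tl ys = take (j - 1) (tl ys) @ ys ! j # drop (Suc (j - 1)) (tl ys)"
    using id_take_nth_drop[OF j(1)] j(2) by simp
  have tl2: "tl (take (Suc j) ys) = take (j - 1) (tl ys) @ [ys ! j]"
    using take_Suc_conv_app_nth[OF j(1)] j(2) assms(3) by (simp add: tl_take)
  have "comp_size (E - B') x = comp_size (E - B) x" if x: "x \<in> set (take (j - 1) (tl ys))" for x
  proof -
    from x obtain i where "i < j - 1" "x = tl ys ! i" "i < length (tl ys)"
      by (auto simp: in_set_conv_nth)
    then show ?thesis using assms(6)[of "Suc i"] by (simp add: nth_tl)
  qed
  then have same: "map (comp_size (E - B')) (take (j - 1) (tl ys)) = map (comp_size (E - B)) (take (j - 1) (tl ys))"
    by simp
  let ?p = "potential (E - B) # map (comp_size (E - B)) (take (j - 1) (tl ys))"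
  have k1: "key B ys = ?p @ comp_size (E - B) (ys ! j) # map (comp_size (E - B)) (drop (Suc (j - 1)) (tl ys))
     @ replicate (card V - length ys) (Suc (card E))"
    unfolding key_def by (subst tl1) simp
  have k2: "key B' (take (Suc j) ys) = ?p @ comp_size (E - B') (ys ! j) #
      replicate (card V - length (take (Suc j) ys)) (Suc (card E))"
    unfolding key_def tl2 map_append same potential by simp
  have "(key B' (take (Suc j) ys), key B ys) \<in> lexn less_than (card V)"
    using length_key[OF st(1-3)] length_key[OF st'] no
    unfolding k1 k2 by (intro lexn_lessI) auto
  then show False using assms(1,2) unfolding minstate_def by blast
qed

text \<open>The components before \<open>j\<close> reach the root through edges that stay blue, and
  they meet no exchanged edge. Hence they and the parent edges leading to the entries up to
  \<open>j\<close> survive, and \<open>take (Suc j) ys\<close> is a legal exploration for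
  \<open>B'\<close> too.\<close>

lemma min_exchange:
  assumes min: "minstate B ys" and tr: "span_forest B'" and B0: "B0 \<subseteq> B" "B0 \<subseteq> B'"
    and j: "0 < j" "j < length ys"
    and rest: "\<And>i u. i < j \<Longrightarrow> u \<in> conn_comp (E - B) (ys ! i) \<Longrightarrow> con B0 u (hd ys)"
    and same: "\<And>i f. i < j \<Longrightarrow> f \<in> (B - B') \<union> (B' - B) \<Longrightarrow> f \<inter> conn_comp (E - B) (ys ! i) = {}"
    and potential: "potential (E - B') \<le> potential (E - B)"
  shows "comp_size (E - B) (ys ! j) \<le> comp_size (E - B') (ys ! j)"
proof -
  have st: "span_forest B" "legal B ys" "3 \<le> comp_size (E - B) (hd ys)" "ys \<noteq> []"
    using min by (auto simp: minstate_def state_def legal_def)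
  have ag: "conn_comp (E - B') (ys ! i) = conn_comp (E - B) (ys ! i)"
    "comp_edges (E - B') (ys ! i) = comp_edges (E - B) (ys ! i)" if "i < j" for i
    by (rule comp_edges_agree; use same[OF that] empty_notin in blast)+
  have hd: "hd (take (Suc j) ys) = hd ys" using st by simp
  have "legal B' (take (Suc j) ys)"
    unfolding legal_def hd
  proof (intro conjI allI impI)
    fix k assume k: "k < length (take (Suc j) ys)"
    then have k': "k < length ys" "k \<le> j" by auto
    show "\<exists>i<k. \<exists>x. con (E - B') (take (Suc j) ys ! i) x \<and> parent B' (hd ys) x (take (Suc j) ys ! k)" if "0 < k"
    proof -
      from st(2) k' that obtain i x where ix: "i < k" "con (E - B) (ys ! i) x" "parent B (hd ys) x (ys ! k)"
        unfolding legal_def by blast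
      then have i: "i < j" using k' by auto
      have x: "x \<in> conn_comp (E - B) (ys ! i)" using ix by (simp add: conn_comp_def)
      have "parent B' (hd ys) x (ys ! k)"
        by (rule parent_preserve(1)[OF st(1) tr B0 ix(3) rest[OF i x]])
      moreover have "con (E - B') (ys ! i) x" using x ag(1)[OF i] by (auto simp: conn_comp_def)
      ultimately show ?thesis using ix k' by (intro exI[of _ i]) auto
    qed
    show "\<not> con (E - B') (take (Suc j) ys ! i) (take (Suc j) ys ! k)" if "i < k" for i
    proof -
      have "\<not> con (E - B) (ys ! i) (ys ! k)" using st(2) that k' unfolding legal_def by auto
      then have "ys ! k \<notin> conn_comp (E - B') (ys ! i)" using ag(1)[of i] that k' by (auto simp: conn_comp_def)
      then show ?thesis using that k' by (auto simp: conn_comp_def)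
    qed
  qed (use st in auto)
  moreover have "comp_size (E - B') (hd ys) = comp_size (E - B) (hd ys)"
    using ag(2)[OF j(1)] st by (simp add: comp_size_def hd_conv_nth)
  ultimately have "state B' (take (Suc j) ys)" using st hd tr unfolding state_def by auto
  from min_step[OF min this j potential] ag(2) show ?thesis by (simp add: comp_size_def)
qed

text \<open>An entry vertex is the parent of a vertex in an earlier component, so the path of that
  vertex to the root inside \<open>B0\<close> runs through it. Consequently, the first component to
  lose contact with the root keeps it at its entry, and some red edge inside it leads across the
  cut.\<close>

lemma min_entry:
  assumes min: "minstate B ys" and B0: "B0 \<subseteq> B" and j: "j < length ys"
    and rest: "\<And>i u. i < j \<Longrightarrow> u \<in> conn_comp (E - B) (ys ! i) \<Longrightarrow> con B0 u (hd ys)"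
  shows "con B0 (ys ! j) (hd ys)"
proof (cases "j = 0")
  case False
  have st: "span_forest B" "legal B ys"
    using min by (auto simp: minstate_def state_def)
  with False j obtain i x where ix: "i < j" "con (E - B) (ys ! i) x" "parent B (hd ys) x (ys ! j)"
    unfolding legal_def by blast
  then have "con B0 x (hd ys)" using rest by (simp add: conn_comp_def)
  then show ?thesis by (rule parent_preserve(2)[OF st(1) st(1) B0 B0 ix(3)])
qed (use j in \<open>cases ys; simp\<close>)

end

section \<open>Components without red edges\<close>

lemma con_pendant:
  assumes "con (insert {x, y} F) w u" "\<And>f. f \<in> F \<Longrightarrow> y \<notin> f" "w \<noteq> y" "u \<noteq> y"
  shows "con F w u"
proof -
  have iso: "z = y" if "con F y z" for z
    using that by (induction rule: con_induct) (use assms(2) in auto)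
  have "\<not> con F w y" using iso con_sym assms(3) by metis
  moreover have "\<not> con F y u" using iso assms(4) by metis
  ultimately show ?thesis using con_insertD[OF assms(1)] by auto
qed

context finite_graph
begin

lemma comp_size_mono_gen:
  assumes "F' \<subseteq> F \<union> A" "\<And>f. f \<in> A \<Longrightarrow> f \<inter> conn_comp F v = {}" "F \<subseteq> E" "F' \<subseteq> E"
  shows "comp_size F' v \<le> comp_size F v" "f \<in> comp_edges F v \<Longrightarrow> f \<notin> F' \<Longrightarrow> comp_size F' v < comp_size F v"
proof -
  have sub: "comp_edges F' v \<subseteq> comp_edges F v \<inter> F'"
    by (rule comp_edges_mono_gen(2)[OF assms(1,2)]) (use empty_notin assms in auto)
  have fin: "finite (comp_edges F v)" using assms finE finite_subset finite_ec by metis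
  show "comp_size F' v \<le> comp_size F v" unfolding comp_size_def by (rule card_mono[OF fin]) (use sub in auto)
  show "comp_size F' v < comp_size F v" if "f \<in> comp_edges F v" "f \<notin> F'"
    unfolding comp_size_def by (rule psubset_card_mono[OF fin]) (use sub that in auto)
qed

lemma in_comp_edgesI: "{a, b} \<in> F \<Longrightarrow> a \<in> conn_comp F v \<Longrightarrow> {a, b} \<in> comp_edges F v"
  using comp_step[of a b F v] by (simp add: comp_edges_def)

lemma comp_size_zero:
  assumes "comp_size F y = 0" "F \<subseteq> E" "f \<in> F"
  shows "y \<notin> f"
proof
  assume "y \<in> f"
  obtain a b where "f = {a, b}" using edge_obtain assms by blast
  with \<open>y \<in> f\<close> obtain z where "f = {y, z}" by auto
  then have "f \<in> comp_edges F y" using assms by (auto intro: in_comp_edgesI)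
  moreover have "finite (comp_edges F y)" using assms finE finite_subset finite_ec by metis
  ultimately show False using assms unfolding comp_size_def by auto
qed

lemma legal_disjoint:
  assumes "legal B ys" "i < length ys" "j < length ys" "i \<noteq> j"
  shows "conn_comp (E - B) (ys ! i) \<inter> conn_comp (E - B) (ys ! j) = {}"
proof -
  have "\<not> con (E - B) (ys ! i) (ys ! j)" using assms con_sym unfolding legal_def by (metis linorder_neqE_nat)
  then show ?thesis using comp_disjoint[of "ys ! j" "E - B" "ys ! i"] by (auto simp: conn_comp_def)
qed

text \<open>Otherwise one could trade the blue edge \<open>{x, y}\<close> for a red edge in the first component that
  is cut off from the root by removing \<open>{x, y}\<close>.\<close>

lemma isolated_child:
  assumes bad: "\<forall>B. span_forest B \<longrightarrow> (\<exists>v. 3 \<le> comp_size (E - B) v)"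
    and min: "minstate B ys" and ik: "k < i" "i < length ys"
    and x: "con (E - B) (ys ! k) x" and parent: "parent B (hd ys) x (ys ! i)" and y0: "comp_size (E - B) (ys ! i) = 0"
  shows "2 \<le> comp_size (E - B) (ys ! k)"
proof (rule ccontr)
  assume "\<not> ?thesis"
  then have small: "comp_size (E - B) (ys ! k) \<le> 1" by simp
  define R where "R = E - B"
  define r where "r = hd ys"
  define y where "y = ys ! i"
  define B0 where "B0 = B - {{x, y}}"
  have st: "span_forest B" "legal B ys" "3 \<le> comp_size R r" "ys \<noteq> []"
    using min by (auto simp: minstate_def state_def legal_def R_def r_def)
  have BE: "B \<subseteq> E" and RE: "R \<subseteq> E" using span_forest_sub[OF st(1)] by (auto simp: R_def)
  have finB: "finite B" and finR: "finite R" using BE RE finE finite_subset by blast+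
  have xy: "{x, y} \<in> B" "x \<noteq> y" and xr: "\<not> con B0 x r" and yr: "con B0 y r" and Ex: "con E r x"
    using parent_edge[OF st(1) parent] parent_head[OF st(1) parent] parent by (auto simp: parent_def B0_def y_def r_def)
  have yR: "y \<notin> f" if "f \<in> R" for f using comp_size_zero y0 RE that by (auto simp: R_def y_def)
  have r0: "r = ys ! 0" using st by (simp add: r_def hd_conv_nth)
  have k: "0 < k" using small st(3) r0 unfolding R_def by (cases k) auto
  have xK: "x \<in> conn_comp R (ys ! k)" using x by (simp add: conn_comp_def R_def)
  have disj: "conn_comp R (ys ! p) \<inter> conn_comp R (ys ! q) = {}" if "p < length ys" "q < length ys" "p \<noteq> q" for p q
    using legal_disjoint[OF st(2) that] by (simp add: R_def)
  have yi: "y \<in> conn_comp R (ys ! i)" by (simp add: y_def)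
  \<comment> \<open>Taking the first component that has lost contact with the root leaves all
    earlier ones intact, so that minimality can be applied at position \<open>j\<close>. Component
    \<open>k\<close> qualifies because it contains \<open>x\<close>.\<close>
  have "\<exists>j\<le>k. (\<exists>u\<in>conn_comp R (ys ! j). \<not> con B0 u r) \<and> (\<forall>i<j. \<not> (\<exists>u\<in>conn_comp R (ys ! i). \<not> con B0 u r))"
    by (rule ex_least_index) (use xK xr in auto)
  then obtain j v where j: "j \<le> k" "v \<in> conn_comp R (ys ! j)" "\<not> con B0 v r"
    and rest: "\<And>i u. i < j \<Longrightarrow> u \<in> conn_comp R (ys ! i) \<Longrightarrow> con B0 u r"
    by auto
  have jl: "j < length ys" using j ik by auto
  define w where "w = ys ! j"
  have wr: "con B0 w r"
    unfolding w_def r_def by (rule min_entry[OF min _ jl]) (use rest in \<open>auto simp: R_def r_def B0_def\<close>)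
  have "con (comp_edges R w) w v" using j(2) by (auto simp: w_def intro: con_in_comp_edges)
  \<comment> \<open>The entry still reaches the root and \<open>v\<close> does not, so a red edge of
    the component bridges the cut; made blue, it replaces \<open>{x, y}\<close> in the
    forest.\<close>
  from con_cross[OF this, of "{u. con B0 u r}"] wr j(3)
  obtain a b where ab: "{a, b} \<in> comp_edges R w" "con B0 a r" "\<not> con B0 b r" by auto
  then have abR: "{a, b} \<in> R" "a \<in> conn_comp R w" "b \<in> conn_comp R w" by (auto simp: comp_edges_def)
  have "con E r w" using legal_con[OF st(1,2) jl] by (simp add: r_def w_def)
  then have "con E r b"
    using abR(3) con_mono[OF _ RE] unfolding conn_comp_def by (auto intro: con_trans)
  then have "con B b r" using span_forest_con[OF st(1)] con_sym by metis
  from con_removeD[OF this, of x y] have bx: "con B0 b x" using ab(3) xr by (auto simp: B0_def)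
  define B' where "B' = insert {a, b} B0"
  have sub0: "B0 \<subseteq> B" "B0 \<subseteq> B'" by (auto simp: B0_def B'_def)
  have abB: "{a, b} \<notin> B" using abR by (auto simp: R_def)
  have tr: "span_forest B'"
  proof (rule span_forest_exchange[OF st(1)])
    show "B' \<subseteq> E" using BE abR by (auto simp: B'_def B0_def R_def)
    show "card B' \<le> card B" using xy(1) abB finB
      by (simp add: B'_def B0_def card_insert_if card_Diff_singleton) (metis card_gt_0_iff Suc_pred empty_iff le_refl)
    have "con B' x r"
    proof -
      have "con B' x b" using con_mono[OF con_sym[OF bx] sub0(2)] .
      moreover have "con B' b a" by (rule con_sym, rule con_edge) (simp add: B'_def)
      moreover have "con B' a r" using con_mono[OF ab(2) sub0(2)] .
      ultimately show ?thesis by (meson con_trans)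
    qed
    moreover have "con B' y r" using con_mono[OF yr sub0(2)] .
    ultimately have "con B' x y" "con B' y x" by (meson con_trans con_sym)+
    then show "con B' p q" if "{p, q} \<in> B" for p q
      using that by (cases "{p, q} = {x, y}") (auto simp: doubleton_eq_iff B'_def B0_def intro: con_edge)
  qed
  define R' where "R' = E - B'"
  have R'E: "R' \<subseteq> E" by (auto simp: R'_def)
  have R': "R' = insert {x, y} (R - {{a, b}})"
    using xy(1) abB BE unfolding R'_def R_def B'_def B0_def by auto
  have subR: "R' \<subseteq> R \<union> {{x, y}}" by (auto simp: R')
  have yK: "y \<notin> conn_comp R (ys ! p)" if "p < length ys" "p \<noteq> i" for p
    using disj[of i p] that ik yi by auto
  have xq: "x \<notin> conn_comp R (ys ! p)" if "p < length ys" "p \<noteq> k" for p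
    using disj[of k p] that ik xK by auto
  have avoid: "{x, y} \<inter> conn_comp R (ys ! p) = {}" if "p < k" for p
    using xq[of p] yK[of p] that ik by auto
  \<comment> \<open>The component of \<open>x\<close> has at most one edge and \<open>y\<close> is
    isolated, so joining them gives at most two edges and weight 0; no other component
    grows.\<close>
  have weight: "weight (comp_size R' u) \<le> weight (comp_size R u)" for u
  proof (cases "u \<in> insert y (conn_comp R x)")
    case True
    have K: "conn_comp R x = conn_comp R (ys ! k)" using comp_eq[OF xK] .
    have yx: "y \<notin> conn_comp R x" using yK[of k] K ik by auto
    have "conn_comp R' u \<subseteq> insert y (conn_comp R x)"
    proof (rule comp_least[OF True])
      fix p q assume pq: "{p, q} \<in> R'" "p \<in> insert y (conn_comp R x)"
      show "q \<in> insert y (conn_comp R x)"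
      proof (cases "{p, q} = {x, y}")
        case False
        then have "{p, q} \<in> R" using pq R' by auto
        then show ?thesis using pq(2) yR comp_step[of p q R x] by auto
      qed (auto simp: doubleton_eq_iff)
    qed
    then have "comp_edges R' u \<subseteq> insert {x, y} (comp_edges R x)"
      using yR R' by (auto simp: comp_edges_def)
    then have "comp_size R' u \<le> card (insert {x, y} (comp_edges R x))"
      unfolding comp_size_def using finR by (intro card_mono) auto
    also have "\<dots> \<le> Suc (card (comp_edges R x))"
      using finR by (simp add: card_insert_if)
    also have "\<dots> \<le> 2" using small comp_size_eq[OF xK] by (simp add: comp_size_def R_def)
    finally show ?thesis by (simp add: weight_def)
  next
    case False
    have "x \<notin> conn_comp R u"
      using False comp_eq[of x R u] self_in_comp[of u R] by auto
    moreover have "y \<notin> conn_comp R u"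
    proof
      assume "y \<in> conn_comp R u"
      then have "u \<in> conn_comp R y" using comp_eq self_in_comp by metis
      moreover have "conn_comp R y \<subseteq> {y}" by (rule comp_least) (use yR in auto)
      ultimately show False using False by auto
    qed
    ultimately    show ?thesis by (intro weight_mono comp_size_mono_gen(1)[OF subR]) (use RE R'E in auto)
  qed
  have strict: "comp_size R' w < comp_size R w" if "j < k"
    by (rule comp_size_mono_gen(2)[OF subR _ RE R'E ab(1)])
      (use avoid[OF that] xy(1) abB in \<open>auto simp: R' w_def\<close>)
  show False
  proof (cases "j = 0")
    case True
    then have "comp_size R' r < comp_size R r" using strict k r0 by (simp add: w_def)
    then have "potential R' < potential R"
      using potential_strict[of R' R r, OF weight bad_in_V[OF st(3) RE] _ st(3)] by blast
    moreover obtain z where "3 \<le> comp_size (E - B') z" using bad tr by blast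
    ultimately show False using min_potential[OF min tr] by (auto simp: R_def R'_def not_le[symmetric])
  next
    case False
    have "comp_size (E - B) (ys ! j) \<le> comp_size (E - B') (ys ! j)"
    proof (rule min_exchange[OF min tr sub0 _ jl])
      show "con B0 u (hd ys)" if "p < j" "u \<in> conn_comp (E - B) (ys ! p)" for p u
        using rest that by (auto simp: R_def r_def)
      show "f \<inter> conn_comp (E - B) (ys ! p) = {}" if "p < j" "f \<in> (B - B') \<union> (B' - B)" for p f
      proof -
        have "f = {x, y} \<or> f = {a, b}" using that(2) by (auto simp: B'_def B0_def)
        then show ?thesis
          using avoid[of p] that(1) j(1) disj[of p j] abR(2,3) jl by (auto simp: R_def w_def)
      qed
      show "potential (E - B') \<le> potential (E - B)" using potential_mono[of R' R] weight by (auto simp: R_def R'_def)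
    qed (use False in simp)
    then have le: "comp_size R w \<le> comp_size R' w" by (simp add: R_def R'_def w_def)
    \<comment> \<open>For \<open>j < k\<close> the component of \<open>w\<close> gains nothing and
      loses \<open>{a, b}\<close>, against minimality. So \<open>{a, b}\<close> is the only edge of
      component \<open>k\<close>, its entry is the end \<open>a\<close> still joined to the root,
      and the exchange leaves \<open>a\<close> isolated: entry \<open>k\<close> drops from 1 to
      0.\<close>
    then have jk: "j = k" using strict j(1) by linarith
    have fin: "finite (comp_edges R w)" using finR by simp
    have ecw: "comp_edges R w = {{a, b}}"
    proof -
      have "card (comp_edges R w) \<le> 1" using small jk by (simp add: comp_size_def R_def w_def)
      then show ?thesis using ab(1) fin by (metis card_le_Suc0_iff_eq One_nat_def insert_absorb singletonI subset_singletonD subsetI insert_not_empty)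
    qed
    have "w = a"
    proof (rule ccontr)
      assume "w \<noteq> a"
      have "con (comp_edges R w) w a" using abR(2) by (rule con_in_comp_edges)
      from con_cross[OF this, of "{w}"] \<open>w \<noteq> a\<close> obtain z where "{w, z} \<in> comp_edges R w" by auto
      then have "w = b" using ecw \<open>w \<noteq> a\<close> by (auto simp: doubleton_eq_iff)
      then show False using ab(3) wr by simp
    qed
    have noa: "a \<notin> f" if "f \<in> R'" for f
    proof
      assume "a \<in> f"
      show False
      proof (cases "f = {x, y}")
        case True
        have "a \<noteq> x" using ab(2) xr by auto
        moreover have "a \<noteq> y" using abR(2) yK[of j] jl jk ik by (auto simp: w_def)
        ultimately show False using True \<open>a \<in> f\<close> by auto
      next
        case False
        then have f: "f \<in> R" "f \<noteq> {a, b}" using that R' by auto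
        obtain p q where "f = {p, q}" using edge_obtain f RE by blast
        with \<open>a \<in> f\<close> obtain q where "f = {a, q}" by auto
        then have "f \<in> comp_edges R w" using f(1) in_comp_edgesI[OF _ abR(2)] by blast
        then show False using ecw f by auto
      qed
    qed
    have "conn_comp R' a \<subseteq> {a}" by (rule comp_least) (use noa in auto)
    then have "f = {}" if "f \<in> comp_edges R' a" for f
      using that noa[of f] unfolding comp_edges_def by blast
    then have "comp_edges R' a = {}" using empty_notin[OF R'E] unfolding comp_edges_def by blast
    then have "comp_size R' w = 0" using \<open>w = a\<close> by (simp add: comp_size_def)
    then show False using le ecw by (simp add: comp_size_def)
  qed
qed

text \<open>Suppose they were connected. A path from \<open>y1\<close> to \<open>r\<close> without
  the first edge either avoids the second one too, and then \<open>x2\<close> reaches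
  \<open>r\<close> through \<open>x1\<close> and \<open>y1\<close>, or it leads to
  \<open>x2\<close>, and then \<open>x1\<close> reaches \<open>r\<close> through \<open>x2\<close>
  and \<open>y1\<close>. Each avoids the respective parent edge.\<close>

lemma tail_separated:
  assumes tr: "span_forest B" and o1: "parent B r x1 y1" and o2: "parent B r x2 y2" and ne: "{x1, y1} \<noteq> {x2, y2}"
  shows "\<not> con (B - {{x1, y1}} - {{x2, y2}}) x1 x2"
proof
  let ?B = "B - {{x1, y1}} - {{x2, y2}}"
  assume c: "con ?B x1 x2"
  have n1: "\<not> con (B - {{x1, y1}}) x1 r" and n2: "\<not> con (B - {{x2, y2}}) x2 r"
    using o1 o2 by (auto simp: parent_def)
  have s1: "con (B - {{x1, y1}}) u v" if "con ?B u v" for u v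
    using that by (rule con_mono) auto
  have s2: "con (B - {{x2, y2}}) u v" if "con ?B u v" for u v
    using that by (rule con_mono) auto
  have e1: "con (B - {{x2, y2}}) x1 y1"
    using ne o1 by (auto simp: parent_def intro: con_edge)
  have h1: "con (B - {{x1, y1}}) y1 r" by (rule parent_head[OF tr o1])
  have "con ?B y1 r \<or> con ?B y1 x2"
    using con_removeD[OF h1, of x2 y2] s2 n2 by auto
  then show False
  proof
    assume "con ?B y1 r"
    then have "con (B - {{x2, y2}}) x2 r"
      using con_trans[OF con_sym[OF s2[OF c]] con_trans[OF e1 s2]] by blast
    then show False using n2 by simp
  next
    assume "con ?B y1 x2"
    then have "con (B - {{x1, y1}}) x1 r"
      using con_trans[OF s1[OF c] con_trans[OF con_sym[OF s1] h1]] by blast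
    then show False using n1 by simp
  qed
qed

lemma two_cut_cover:
  assumes tr: "span_forest B" and o1: "parent B r x1 y1" and o2: "parent B r x2 y2" and ne: "{x1, y1} \<noteq> {x2, y2}"
    and v: "con E r v"
  shows "con (B - {{x1, y1}} - {{x2, y2}}) v r \<or> con (B - {{x1, y1}} - {{x2, y2}}) v x1
    \<or> con (B - {{x1, y1}} - {{x2, y2}}) v x2"
proof -
  let ?B = "B - {{x1, y1}} - {{x2, y2}}"
  have n1: "\<not> con (B - {{x1, y1}}) x1 r" and n2: "\<not> con (B - {{x2, y2}}) x2 r"
    using o1 o2 by (auto simp: parent_def)
  have n2': "\<not> con ?B x2 r" using n2 by (auto elim!: contrapos_nn con_mono)
  have n12: "\<not> con ?B x2 x1" using tail_separated[OF assms(1-4)] con_sym by metis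
  have "con B v r" using v span_forest_con[OF tr] con_sym by metis
  then have "con (B - {{x1, y1}}) v r \<or> con (B - {{x1, y1}}) v x1"
    using con_removeD[of B v r x1 y1] n1 by auto
  then show ?thesis
    using con_removeD[of "B - {{x1, y1}}" v r x2 y2] con_removeD[of "B - {{x1, y1}}" v x1 x2 y2] n2' n12
    by auto
qed

text \<open>The cardinality assumption makes the component a tree: if it stayed connected without
  one of its edges, it would have too few edges for its number of vertices.\<close>

lemma comp_bridge:
  assumes "F \<subseteq> E" "v \<in> V" "{c, d} \<in> comp_edges F v" "comp_size F v + 1 \<le> card (conn_comp F v)"
  shows "\<not> con (F - {{c, d}}) c d"
proof
  assume *: "con (F - {{c, d}}) c d"
  have finF: "finite F" using assms finE finite_subset by auto
  have pq: "con (F - {{c, d}}) p q" if "{p, q} \<in> F" for p q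
    using that * by (cases "{p, q} = {c, d}") (auto simp: doubleton_eq_iff intro: con_edge con_sym)
  have "con F v u \<Longrightarrow> con (F - {{c, d}}) v u" for u
    by (rule con_subst[OF _ pq])
  then have eq: "conn_comp (F - {{c, d}}) v = conn_comp F v"
    unfolding conn_comp_def by (auto elim: con_mono)
  then have "comp_edges (F - {{c, d}}) v = comp_edges F v - {{c, d}}" by (auto simp: comp_edges_def)
  then have "comp_size (F - {{c, d}}) v < comp_size F v"
    unfolding comp_size_def using assms(3) finF by (metis card_Diff1_less finite_ec)
  moreover have "finite (conn_comp F v)"
    by (rule finite_subset[OF _ finV]) (use con_in_V assms in \<open>auto simp: conn_comp_def\<close>)
  then have "card (conn_comp F v) \<le> comp_size (F - {{c, d}}) v + 1"
    using card_comp_le[of "F - {{c, d}}" v] eq finF by simp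
  ultimately show False using assms(4) by linarith
qed

text \<open>Here \<open>m\<close> and \<open>n\<close> are the numbers of vertices on the two sides
  when a tree with \<open>m + n - 1\<close> edges is cut at an edge. After each side has received a
  new leaf, it has \<open>m + 1\<close> vertices and \<open>m\<close> edges, respectively
  \<open>n + 1\<close> and \<open>n\<close>.\<close>

lemma weight_split:
  assumes "1 \<le> m" "1 \<le> n"
  shows "(m + 1) * weight m + (n + 1) * weight n \<le> (m + n) * weight (m + n - 1)"
proof -
  consider "m \<le> 2" "n \<le> 2" | "m \<le> 2" "3 \<le> n" | "3 \<le> m" "n \<le> 2" | "3 \<le> m" "3 \<le> n" by linarith
  then show ?thesis
  proof cases
    case 2
    have "(n + 1) * n \<le> (m + n) * (m + n - 1)" using assms by (intro mult_mono) auto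
    with 2 assms show ?thesis by (simp add: weight_def)
  next
    case 3
    have "(m + 1) * m \<le> (m + n) * (m + n - 1)" using assms by (intro mult_mono) auto
    with 3 assms show ?thesis by (simp add: weight_def)
  next
    case 4
    then obtain p q where pq: "m = p + 3" "n = q + 3" using le_iff_add by (metis add.commute)
    show ?thesis using 4 unfolding pq by (simp add: weight_def algebra_simps)
  qed (simp add: weight_def)
qed

text \<open>The potential is unchanged if the component splits off a single vertex, which is then joined
  to \<open>y1\<close>; that is why \<open>weight\<close> vanishes up to 2.\<close>

lemma potential_split:
  assumes RE: "R \<subseteq> E" and e: "{x1, y1} \<in> E" "{x2, y2} \<in> E" "y1 \<noteq> y2"
    and y: "comp_size R y1 = 0" "comp_size R y2 = 0"
    and con: "con R x1 x2" and span_forest: "comp_size R x1 + 1 \<le> card (conn_comp R x1)" and big: "2 \<le> comp_size R x1"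
    and cd: "{c, d} \<in> comp_edges R x1" and sep: "\<not> con (R - {{c, d}}) x1 x2"
  shows "potential (insert {x1, y1} (insert {x2, y2} (R - {{c, d}}))) \<le> potential R"
proof -
  define F where "F = R - {{c, d}}"
  define R1 where "R1 = insert {x1, y1} (insert {x2, y2} F)"
  define K1 where "K1 = conn_comp F x1"
  define K2 where "K2 = conn_comp F x2"
  define K where "K = conn_comp R x1"
  have sep': "\<not> con F x1 x2" using sep by (simp add: F_def)
  have FE: "F \<subseteq> E" and R1E: "R1 \<subseteq> E" using RE e by (auto simp: F_def R1_def)
  have finF: "finite F" and finR: "finite R" using FE RE finE finite_subset by blast+
  have x2K: "x2 \<in> K" using con by (simp add: K_def conn_comp_def)
  have yR: "y1 \<notin> f" "y2 \<notin> f" if "f \<in> R" for f using comp_size_zero y RE that by auto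
  have inV: "x1 \<in> V" "x2 \<in> V" "y1 \<in> V" "y2 \<in> V" using e edgeD by blast+
  have KV: "K \<subseteq> V" using con_in_V RE inV by (auto simp: K_def conn_comp_def)
  have yK: "y1 \<notin> K" "y2 \<notin> K"
    using comp_size_eq[of y1 R x1] comp_size_eq[of y2 R x1] y big by (auto simp: K_def)
  have disj: "K1 \<inter> K2 = {}"
    using sep' unfolding K1_def K2_def by (intro comp_disjoint) (auto simp: conn_comp_def dest: con_sym)
  have K12: "K = K1 \<union> K2"
  proof
    have "K1 \<subseteq> K" "K2 \<subseteq> K"
      using con by (auto simp: K_def K1_def K2_def F_def conn_comp_def intro: con_trans elim: con_mono)
    then show "K1 \<union> K2 \<subseteq> K" by simp
    show "K \<subseteq> K1 \<union> K2"
    proof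
      fix u assume "u \<in> K"
      then have "con R x1 u" by (simp add: K_def conn_comp_def)
      from con_removeD[OF this, of c d] con_removeD[OF con, of c d] sep'
      have "con F x1 u \<or> con F x2 u" unfolding F_def by (metis con_sym con_trans)
      then show "u \<in> K1 \<union> K2" by (auto simp: K1_def K2_def conn_comp_def)
    qed
  qed
  have finK: "finite K" "finite K1" "finite K2" using KV K12 finV finite_subset by blast+
  \<comment> \<open>The number of vertices of the part if it is a tree, and a bound for its number
    of edges once \<open>{x1, y1}\<close> is attached.\<close>
  define n1 where "n1 = comp_size F x1 + 1"
  define n2 where "n2 = comp_size F x2 + 1"
  have k1: "card K1 \<le> n1" and k2: "card K2 \<le> n2"
    using card_comp_le[of F] finF finK by (auto simp: n1_def n2_def K1_def K2_def)
  have n12: "n1 + n2 \<le> comp_size R x1 + 1"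
  proof -
    have "card (comp_edges F x1 \<union> comp_edges F x2) = card (comp_edges F x1) + card (comp_edges F x2)"
    proof (rule card_Un_disjoint)
      show "comp_edges F x1 \<inter> comp_edges F x2 = {}"
      proof -
        have "f = {}" if "f \<in> comp_edges F x1" "f \<in> comp_edges F x2" for f
          using that disj unfolding comp_edges_def K1_def[symmetric] K2_def[symmetric] by blast
        moreover have "{} \<notin> comp_edges F x1" using empty_notin[OF FE] by (simp add: comp_edges_def)
        ultimately show ?thesis by blast
      qed
    qed (use finF in auto)
    moreover have "insert {c, d} (comp_edges F x1 \<union> comp_edges F x2) \<subseteq> comp_edges R x1"
      using cd K12 by (auto simp: comp_edges_def F_def K1_def K2_def K_def)
    then have "card (insert {c, d} (comp_edges F x1 \<union> comp_edges F x2)) \<le> comp_size R x1"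
      unfolding comp_size_def using finR by (intro card_mono) auto
    moreover have "{c, d} \<notin> comp_edges F x1 \<union> comp_edges F x2" by (auto simp: comp_edges_def F_def)
    ultimately show ?thesis using finF by (simp add: n1_def n2_def comp_size_def)
  qed
  have "card K = card K1 + card K2" using K12 disj finK by (simp add: card_Un_disjoint)
  \<comment> \<open>As \<open>K\<close> has at least \<open>comp_size R x1 + 1\<close> vertices, all
    preceding upper bounds are tight: both parts are trees.\<close>
  with k1 k2 n12 span_forest have kk: "card K1 = n1" "card K2 = n2" "comp_size R x1 = n1 + n2 - 1" "card K = n1 + n2"
    unfolding K_def by linarith+
  have xK: "x1 \<in> K1" "x2 \<in> K2" by (auto simp: K1_def K2_def)
  have step: "p \<in> K1 \<longleftrightarrow> q \<in> K1" "p \<in> K2 \<longleftrightarrow> q \<in> K2" if "{p, q} \<in> F" for p q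
    unfolding K1_def K2_def using comp_step[OF that] by auto
  have yF: "y1 \<notin> f" "y2 \<notin> f" if "f \<in> F" for f using yR that by (auto simp: F_def)
  have y12: "y1 \<notin> K1" "y1 \<notin> K2" "y2 \<notin> K1" "y2 \<notin> K2" using yK K12 by auto
  have dd: "x1 \<notin> K2" "x2 \<notin> K1" using disj xK by auto
  have W1: "comp_size R1 v \<le> n1" if v: "v \<in> insert y1 K1" for v
  proof -
    have "conn_comp R1 v \<subseteq> insert y1 K1"
    proof (rule comp_least[OF v])
      fix p q assume pq: "{p, q} \<in> R1" "p \<in> insert y1 K1"
      then consider "{p, q} = {x1, y1}" | "{p, q} = {x2, y2}" | "{p, q} \<in> F" by (auto simp: R1_def)
      then show "q \<in> insert y1 K1"
      proof cases
        case 3 then show ?thesis using pq(2) step(1) yF by auto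
      qed (use pq(2) xK y12 dd e(3) in \<open>auto simp: doubleton_eq_iff\<close>)
    qed
    then have "comp_edges R1 v \<subseteq> insert {x1, y1} (comp_edges F x1)"
      using yF y12 dd e(3) by (auto simp: comp_edges_def R1_def K1_def)
    then have "comp_size R1 v \<le> card (insert {x1, y1} (comp_edges F x1))"
      unfolding comp_size_def using finF by (intro card_mono) auto
    then show ?thesis using finF by (simp add: n1_def comp_size_def card_insert_if split: if_splits)
  qed
  have W2: "comp_size R1 v \<le> n2" if v: "v \<in> insert y2 K2" for v
  proof -
    have "conn_comp R1 v \<subseteq> insert y2 K2"
    proof (rule comp_least[OF v])
      fix p q assume pq: "{p, q} \<in> R1" "p \<in> insert y2 K2"
      then consider "{p, q} = {x1, y1}" | "{p, q} = {x2, y2}" | "{p, q} \<in> F" by (auto simp: R1_def)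
      then show "q \<in> insert y2 K2"
      proof cases
        case 3 then show ?thesis using pq(2) step(2) yF by auto
      qed (use pq(2) xK y12 dd e(3) in \<open>auto simp: doubleton_eq_iff\<close>)
    qed
    then have "comp_edges R1 v \<subseteq> insert {x2, y2} (comp_edges F x2)"
      using yF y12 dd e(3) by (auto simp: comp_edges_def R1_def K2_def)
    then have "comp_size R1 v \<le> card (insert {x2, y2} (comp_edges F x2))"
      unfolding comp_size_def using finF by (intro card_mono) auto
    then show ?thesis using finF by (simp add: n2_def comp_size_def card_insert_if split: if_splits)
  qed
  define W where "W = insert y1 K1 \<union> insert y2 K2"
  have WV: "W \<subseteq> V" using KV K12 inV by (auto simp: W_def)
  have parent: "weight (comp_size R1 v) \<le> weight (comp_size R v)" if "v \<in> V - W" for v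
  proof (rule weight_mono, rule comp_size_mono_gen(1))
    show "R1 \<subseteq> R \<union> {{x1, y1}, {x2, y2}}" by (auto simp: R1_def F_def)
    have vK: "v \<notin> K" "v \<noteq> y1" "v \<noteq> y2" using that K12 by (auto simp: W_def)
    have "conn_comp R v \<inter> K = {}" unfolding K_def by (rule comp_disjoint) (use vK in \<open>simp add: K_def\<close>)
    moreover have "y1 \<notin> conn_comp R v" "y2 \<notin> conn_comp R v"
    proof -
      have "conn_comp R v \<subseteq> - {y1, y2}" by (rule comp_least) (use vK yR in auto)
      then show "y1 \<notin> conn_comp R v" "y2 \<notin> conn_comp R v" by auto
    qed
    ultimately show "f \<inter> conn_comp R v = {}" if "f \<in> {{x1, y1}, {x2, y2}}" for f
      using that xK K12 by auto
  qed (use RE R1E in auto)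
  have "potential R1 = (\<Sum>v\<in>V - W. weight (comp_size R1 v)) + (\<Sum>v\<in>W. weight (comp_size R1 v))"
    unfolding potential_def by (rule sum.subset_diff[OF WV finV])
  also have "(\<Sum>v\<in>W. weight (comp_size R1 v)) = (\<Sum>v\<in>insert y1 K1. weight (comp_size R1 v)) + (\<Sum>v\<in>insert y2 K2. weight (comp_size R1 v))"
    unfolding W_def using finK disj y12 e(3) by (intro sum.union_disjoint) auto
  also have "(\<Sum>v\<in>insert y1 K1. weight (comp_size R1 v)) \<le> card (insert y1 K1) * weight n1"
    using sum_bounded_above[of "insert y1 K1" "\<lambda>v. weight (comp_size R1 v)" "weight n1"] W1 weight_mono by auto
  also have "(\<Sum>v\<in>insert y2 K2. weight (comp_size R1 v)) \<le> card (insert y2 K2) * weight n2"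
    using sum_bounded_above[of "insert y2 K2" "\<lambda>v. weight (comp_size R1 v)" "weight n2"] W2 weight_mono by auto
  also have "card (insert y1 K1) * weight n1 + card (insert y2 K2) * weight n2 \<le> (n1 + n2) * weight (n1 + n2 - 1)"
    using weight_split[of n1 n2] finK y12 kk by (simp add: n1_def n2_def)
  also have "(n1 + n2) * weight (n1 + n2 - 1) = (\<Sum>v\<in>K. weight (comp_size R v))"
  proof -
    have "weight (comp_size R v) = weight (n1 + n2 - 1)" if "v \<in> K" for v
      using comp_size_eq[of v R x1] that kk(3) by (simp add: K_def)
    then show ?thesis using kk(4) by simp
  qed
  also have "(\<Sum>v\<in>K. weight (comp_size R v)) \<le> (\<Sum>v\<in>W. weight (comp_size R v))"
    using finK K12 by (intro sum_mono2) (auto simp: W_def)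
  also have "(\<Sum>v\<in>V - W. weight (comp_size R1 v)) \<le> (\<Sum>v\<in>V - W. weight (comp_size R v))"
    by (rule sum_mono) (use parent in auto)
  also have "(\<Sum>v\<in>V - W. weight (comp_size R v)) + (\<Sum>v\<in>W. weight (comp_size R v)) = potential R"
    unfolding potential_def by (rule sum.subset_diff[OF WV finV, symmetric])
  finally show ?thesis by (simp add: R1_def F_def)
qed

text \<open>Here two blue edges are exchanged for two red ones: \<open>{a, b}\<close>, taken from the first component that
  is cut off from the root, and \<open>{c, d}\<close>, which separates \<open>x1\<close> from \<open>x2\<close> in their component and thus
  keeps it from growing.\<close>

lemma two_isolated_children_aux:
  assumes bad: "\<forall>B. span_forest B \<longrightarrow> (\<exists>v. 3 \<le> comp_size (E - B) v)"
    and min: "minstate B ys"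
    and k: "0 < k" "k < i1" "k < i2" "i1 < length ys" "i2 < length ys" "i1 \<noteq> i2"
    and x1: "con (E - B) (ys ! k) x1" and o1: "parent B (hd ys) x1 (ys ! i1)"
    and x2: "con (E - B) (ys ! k) x2" and o2: "parent B (hd ys) x2 (ys ! i2)"
    and y0: "comp_size (E - B) (ys ! i1) = 0" "comp_size (E - B) (ys ! i2) = 0"
    and span_forest: "comp_size (E - B) (ys ! k) + 1 \<le> card (conn_comp (E - B) (ys ! k))"
    and big: "2 \<le> comp_size (E - B) (ys ! k)"
    and B0: "B0 = B - {{x1, ys ! i1}} - {{x2, ys ! i2}}"
    and j: "j \<le> k"
    and rest: "\<And>i u. i < j \<Longrightarrow> u \<in> conn_comp (E - B) (ys ! i) \<Longrightarrow> con B0 u (hd ys)"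
    and ab: "{a, b} \<in> comp_edges (E - B) (ys ! j)" "con B0 a (hd ys)" "con B0 b x1"
  shows False
proof -
  define R where "R = E - B"
  define r where "r = hd ys"
  define y1 where "y1 = ys ! i1"
  define y2 where "y2 = ys ! i2"
  define w where "w = ys ! j"
  have st: "span_forest B" "legal B ys" "3 \<le> comp_size R r" "ys \<noteq> []"
    using min by (auto simp: minstate_def state_def legal_def R_def r_def)
  have BE: "B \<subseteq> E" and RE: "R \<subseteq> E" using span_forest_sub[OF st(1)] by (auto simp: R_def)
  have finB: "finite B" and finR: "finite R" using BE RE finE finite_subset by blast+
  have r0: "r = ys ! 0" using st by (simp add: r_def hd_conv_nth)
  have kl: "k < length ys" and jl: "j < length ys" using k j by auto
  have disj: "conn_comp R (ys ! p) \<inter> conn_comp R (ys ! q) = {}" if "p < length ys" "q < length ys" "p \<noteq> q" for p q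
    using legal_disjoint[OF st(2) that] by (simp add: R_def)
  have yi: "y1 \<in> conn_comp R (ys ! i1)" "y2 \<in> conn_comp R (ys ! i2)" by (simp_all add: y1_def y2_def)
  have y12: "y1 \<noteq> y2" using disj[of i1 i2] yi k by auto
  have yR: "y1 \<notin> f" "y2 \<notin> f" if "f \<in> R" for f using comp_size_zero y0 RE that by (auto simp: R_def y1_def y2_def)
  have xK: "x1 \<in> conn_comp R (ys ! k)" "x2 \<in> conn_comp R (ys ! k)"
    using x1 x2 by (simp_all add: conn_comp_def R_def)
  have yK: "y1 \<notin> conn_comp R (ys ! p)" "y2 \<notin> conn_comp R (ys ! p)" if "p \<le> k" for p
    using disj[of i1 p] disj[of i2 p] that k yi by auto
  have xq: "x1 \<notin> conn_comp R (ys ! p)" "x2 \<notin> conn_comp R (ys ! p)" if "p < k" for p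
    using disj[of k p] that k xK by auto
  have xy: "{x1, y1} \<in> B" "{x2, y2} \<in> B" "x1 \<noteq> y1" "x2 \<noteq> y2"
    using parent_edge[OF st(1) o1] parent_edge[OF st(1) o2] by (auto simp: y1_def y2_def)
  have xy': "x1 \<noteq> y2" "x2 \<noteq> y1" using xK yK[of k] by auto
  have ne: "{x1, y1} \<noteq> {x2, y2}" using xy' y12 by (auto simp: doubleton_eq_iff)
  have B0': "B0 = B - {{x1, y1}} - {{x2, y2}}" using B0 by (simp add: y1_def y2_def)
  have o1': "parent B r x1 y1" and o2': "parent B r x2 y2" using o1 o2 by (auto simp: r_def y1_def y2_def)
  have n1: "\<not> con B0 x1 r" and n2: "\<not> con B0 x2 r"
    using o1' o2' con_mono[of B0 x1 r "B - {{x1, y1}}"] con_mono[of B0 x2 r "B - {{x2, y2}}"]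
    unfolding parent_def B0' by blast+
  have n12: "\<not> con B0 x1 x2" using tail_separated[OF st(1) o1' o2' ne] by (simp add: B0')
  have cover: "con B0 v r \<or> con B0 v x1 \<or> con B0 v x2" if "con E r v" for v
    using two_cut_cover[OF st(1) o1' o2' ne that] by (simp add: B0')
  have Er: "con E r (ys ! p)" if "p < length ys" for p
    using legal_con[OF st(1,2) that] by (simp add: r_def)
  have rV: "r \<in> V" using bad_in_V[OF st(3) RE] .
  have abR: "{a, b} \<in> R" "a \<in> conn_comp R w" "b \<in> conn_comp R w" and abec: "{a, b} \<in> comp_edges R w"
    using ab(1) by (auto simp: comp_edges_def R_def w_def)
  have abr: "con B0 a r" using ab(2) by (simp add: r_def)
  have K: "conn_comp R x1 = conn_comp R (ys ! k)" "comp_size R x1 = comp_size R (ys ! k)"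
    using comp_eq[OF xK(1)] comp_size_eq[OF xK(1)] by auto
  have "con R x2 x1" unfolding R_def by (rule con_trans[OF con_sym[OF x2] x1])
  \<comment> \<open>Besides separating \<open>x1\<close> from \<open>x2\<close> in red, the edge
    must leave the \<open>B0\<close>-part of \<open>x2\<close>, so as to reattach that part once it
    is blue. It lies on a red path from \<open>x2\<close> to \<open>x1\<close>; the component being
    a tree, it separates them.\<close>
  from con_cross_essential[OF finR this, of "{u. con B0 u x2}"] n12
  obtain c' d' where cd': "{c', d'} \<in> R" "con (R - {{c', d'}}) x2 c'" "con (R - {{c', d'}}) d' x1"
    "con B0 c' x2 \<longleftrightarrow> \<not> con B0 d' x2" by auto
  have c'K: "c' \<in> conn_comp R x1"
    using \<open>con R x2 x1\<close> cd'(2) by (auto simp: conn_comp_def intro: con_trans con_sym elim: con_mono)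
  have tr': "comp_size R x1 + 1 \<le> card (conn_comp R x1)" using span_forest K by (simp add: R_def)
  have x1V: "x1 \<in> V" using xy BE edgeD by blast
  have "\<not> con (R - {{c', d'}}) c' d'"
    by (rule comp_bridge[OF RE x1V in_comp_edgesI[OF cd'(1) c'K] tr'])
  then have sep': "\<not> con (R - {{c', d'}}) x1 x2"
    using cd'(2,3) by (meson con_sym con_trans)
  have "\<exists>c d. {c, d} = {c', d'} \<and> \<not> con B0 c x2 \<and> con B0 d x2"
    using cd'(4) by (metis insert_commute)
  then obtain c d where cd: "{c, d} = {c', d'}" "\<not> con B0 c x2" "con B0 d x2" by auto
  have cdR: "{c, d} \<in> R" and sep: "\<not> con (R - {{c, d}}) x1 x2" and cdec: "{c, d} \<in> comp_edges R x1"
    using cd' cd(1) sep' in_comp_edgesI[OF cd'(1) c'K] by auto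
  have cdK: "c \<in> conn_comp R (ys ! k)" "d \<in> conn_comp R (ys ! k)"
    using cdec K by (auto simp: comp_edges_def)
  \<comment> \<open>\<open>a\<close>, \<open>b\<close> and \<open>d\<close> lie in the three
    different parts left by the cut, those of \<open>r\<close>, \<open>x1\<close> and
    \<open>x2\<close>.\<close>
  have "d \<noteq> a" using cd(3) abr n2 con_sym con_trans by metis
  moreover have "d \<noteq> b" using cd(3) ab(3) n12 con_sym con_trans by metis
  ultimately have abcd: "{a, b} \<noteq> {c, d}" by (auto simp: doubleton_eq_iff)
  define B' where "B' = insert {a, b} (insert {c, d} B0)"
  have sub0: "B0 \<subseteq> B" "B0 \<subseteq> B'" by (auto simp: B0' B'_def)
  have abB: "{a, b} \<notin> B" "{c, d} \<notin> B" using abR cdR by (auto simp: R_def)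
  have B'E: "B' \<subseteq> E" using BE abR cdR by (auto simp: B'_def B0' R_def)
  have up: "con B' u v" if "con B0 u v" for u v using con_mono[OF that sub0(2)] .
  have x1r: "con B' x1 r"
  proof -
    have "con B' b a" by (rule con_sym, rule con_edge) (simp add: B'_def)
    then show ?thesis using up[OF con_sym[OF ab(3)]] up[OF abr] by (meson con_trans)
  qed
  \<comment> \<open>\<open>c\<close> lies outside the part of \<open>x2\<close>; if it is in the
    part of \<open>x1\<close>, then \<open>{a, b}\<close> has already reattached that part.\<close>
  have "con B' c r"
  proof -
    have "con E r c"
      using Er[OF kl] cdK(1) con_mono[OF _ RE] unfolding conn_comp_def by (auto intro: con_trans)
    then have "con B0 c r \<or> con B0 c x1" using cover cd(2) by blast
    then show ?thesis using x1r up con_trans by metis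
  qed
  moreover have "con B' d c" by (rule con_sym, rule con_edge) (simp add: B'_def)
  ultimately have x2r: "con B' x2 r" using up[OF con_sym[OF cd(3)]] con_trans by metis
  have all: "con B' v r" if "con E r v" for v
    using cover[OF that] up x1r x2r con_trans by metis
  have tr: "span_forest B'"
  proof (rule span_forest_exchange[OF st(1) B'E])
    have "card B0 + 2 = card B"
      using xy ne finB card_Suc_Diff1[of B "{x1, y1}"] card_Suc_Diff1[of "B - {{x1, y1}}" "{x2, y2}"]
      by (simp add: B0')
    moreover have "card B' \<le> card B0 + 2"
      unfolding B'_def using finB by (auto simp: B0' card_insert_if)
    ultimately show "card B' \<le> card B" by simp
    have e1: "con B' x1 y1" "con B' x2 y2"
      using x1r x2r all[OF parent_con[OF st(1) o1']] all[OF parent_con[OF st(1) o2']]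
      by (meson con_trans con_sym)+
    show "con B' p q" if pq: "{p, q} \<in> B" for p q
    proof -
      consider "{p, q} = {x1, y1}" | "{p, q} = {x2, y2}" | "{p, q} \<in> B'"
        using pq unfolding B'_def B0' by blast
      then show ?thesis
        by cases (use e1 e1[THEN con_sym] in \<open>auto simp: doubleton_eq_iff intro: con_edge\<close>)
    qed
  qed
  define R' where "R' = E - B'"
  \<comment> \<open>\<open>R1\<close> performs only the split, with \<open>{a, b}\<close> still red.
    It separates the cost estimate of \<open>potential_split\<close> from the gain, which is the
    loss of \<open>{a, b}\<close>.\<close>
  define R1 where "R1 = insert {x1, y1} (insert {x2, y2} (R - {{c, d}}))"
  have R'E: "R' \<subseteq> E" and R1E: "R1 \<subseteq> E" using xy BE RE by (auto simp: R'_def R1_def)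
  have R': "R' = R1 - {{a, b}}"
    using xy(1,2) abB BE unfolding R'_def R1_def R_def B'_def B0' by auto
  have rho1: "potential R1 \<le> potential R"
    unfolding R1_def
    by (rule potential_split[OF RE _ _ y12 _ _ con_sym[OF \<open>con R x2 x1\<close>] tr' _ cdec sep])
      (use xy BE y0 big K in \<open>auto simp: R_def y1_def y2_def\<close>)
  have mono: "comp_size R' v \<le> comp_size R1 v" for v using R' R1E by (intro comp_size_mono) auto
  have rho': "potential R' \<le> potential R1" by (rule potential_mono) (use mono weight_mono in auto)
  have subR: "R' \<subseteq> R \<union> {{x1, y1}, {x2, y2}}" by (auto simp: R' R1_def)
  have abnR': "{a, b} \<notin> R'" by (simp add: R')
  have strict: "comp_size R' w < comp_size R w" if "j < k"
    by (rule comp_size_mono_gen(2)[OF subR _ RE R'E abec abnR'])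
      (use xq[OF that] yK[of j] j in \<open>auto simp: w_def\<close>)
  show False
  proof (cases "j = 0")
    case True
    have w: "w = r" using True r0 by (simp add: w_def)
    \<comment> \<open>The split takes place in component \<open>k\<close>, away from the root
      component. The latter is therefore still large in \<open>R1\<close>, and losing
      \<open>{a, b}\<close> makes the potential drop.\<close>
    have "comp_edges R1 r = comp_edges R r"
    proof (rule comp_edges_agree)
      fix f assume "f \<in> (R - R1) \<union> (R1 - R)"
      then have "f = {c, d} \<or> f = {x1, y1} \<or> f = {x2, y2}" by (auto simp: R1_def)
      then show "f \<inter> conn_comp R r = {}"
        using xq[of 0] yK[of 0] k(1) cdK disj[of 0 k] kl r0 st(4) by auto
    qed (use empty_notin RE R1E in auto)
    then have eq: "comp_size R1 r = comp_size R r" by (simp add: comp_size_def)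
    have "potential R' < potential R1"
      by (rule potential_strict[OF _ rV]) (use mono weight_mono eq strict True k(1) w st(3) in auto)
    moreover obtain z where "3 \<le> comp_size (E - B') z" using bad tr by blast
    then have "potential R \<le> potential R'" using min_potential[OF min tr] by (auto simp: R_def R'_def)
    ultimately show False using rho1 by simp
  next
    case False
    have "comp_size (E - B) (ys ! j) \<le> comp_size (E - B') (ys ! j)"
    proof (rule min_exchange[OF min tr sub0 _ jl rest])
      show "f \<inter> conn_comp (E - B) (ys ! p) = {}" if "p < j" "f \<in> (B - B') \<union> (B' - B)" for p f
      proof -
        have p: "p < k" "p < length ys" using that j kl by auto
        have "f = {x1, y1} \<or> f = {x2, y2} \<or> f = {a, b} \<or> f = {c, d}"
          using that(2) by (auto simp: B'_def B0')
        then show ?thesis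
          using xq[OF p(1)] yK[of p] disj[of p j] disj[of p k] abR(2,3) cdK jl kl that(1) p
          unfolding R_def[symmetric] w_def by auto
      qed
      show "potential (E - B') \<le> potential (E - B)" using rho1 rho' by (simp add: R_def R'_def)
    qed (use False in auto)
    then have le: "comp_size R w \<le> comp_size R' w" by (simp add: R_def R'_def w_def)
    then have jk: "j = k" using strict j by linarith
    define F where "F = R - {{a, b}} - {{c, d}}"
    have yF: "y1 \<notin> f" "y2 \<notin> f" if "f \<in> F" for f using yR that by (auto simp: F_def)
    have R'F: "R' = insert {x1, y1} (insert {x2, y2} F)"
      using xy abB by (auto simp: R' R1_def F_def)
    have wy: "w \<noteq> y1" "w \<noteq> y2" using yK[of k] jk by (auto simp: w_def)
    have pend: "con F w u" if "con R' w u" "u \<noteq> y1" "u \<noteq> y2" for u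
    proof (rule con_pendant[of x2 y2], rule con_pendant[of x1 y1])
      show "con (insert {x1, y1} (insert {x2, y2} F)) w u" using that R'F by simp
      show "y1 \<notin> f" if "f \<in> insert {x2, y2} F" for f using that yF xy' y12 by auto
    qed (use wy that yF in auto)
    \<comment> \<open>Both \<open>{a, b}\<close> and \<open>{c, d}\<close> now leave component
      \<open>k\<close>. Only one of the two pendant edges can hang on the part of the entry
      \<open>w\<close>, because \<open>{c, d}\<close> separated \<open>x1\<close> from
      \<open>x2\<close>; so entry \<open>k\<close> drops by at least one.\<close>
    have "\<not> (con R' w x1 \<and> con R' w x2)"
    proof
      assume "con R' w x1 \<and> con R' w x2"
      then have "con F w x1" "con F w x2" using pend xy xy' by auto
      then have "con F x1 x2" by (meson con_sym con_trans)
      then have "con (R - {{c, d}}) x1 x2" by (rule con_mono) (auto simp: F_def)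
      then show False using sep by simp
    qed
    then have "{x1, y1} \<notin> comp_edges R' w \<or> {x2, y2} \<notin> comp_edges R' w" by (auto simp: comp_edges_def conn_comp_def)
    moreover have old: "f \<in> comp_edges R w - {{a, b}} - {{c, d}}" if f: "f \<in> comp_edges R' w" "f \<noteq> {x1, y1}" "f \<noteq> {x2, y2}" for f
    proof -
      have fF: "f \<in> F" and fc: "f \<subseteq> conn_comp R' w" using f R'F by (auto simp: comp_edges_def)
      have "u \<in> conn_comp R w" if "u \<in> f" for u
      proof -
        have "con R' w u" "u \<noteq> y1" "u \<noteq> y2" using that fc yF[OF fF] by (auto simp: conn_comp_def)
        then have "con F w u" by (rule pend)
        then have "con R w u" by (rule con_mono) (auto simp: F_def)
        then show ?thesis by (simp add: conn_comp_def)
      qed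
      then show ?thesis using fF by (auto simp: comp_edges_def F_def)
    qed
    ultimately obtain e where e: "comp_edges R' w \<subseteq> insert e (comp_edges R w - {{a, b}} - {{c, d}})"
      using that[of "{x1, y1}"] that[of "{x2, y2}"] by (metis insert_iff subsetI)
    have "comp_size R' w \<le> card (insert e (comp_edges R w - {{a, b}} - {{c, d}}))"
      unfolding comp_size_def using e finR by (intro card_mono) auto
    also have "\<dots> \<le> Suc (card (comp_edges R w - {{a, b}} - {{c, d}}))"
      using finR by (simp add: card_insert_if)
    also have "\<dots> < comp_size R w"
    proof -
      have "{c, d} \<in> comp_edges R w" using cdec K comp_eq[OF xK(1)] jk by (simp add: comp_edges_def w_def)
      then show ?thesis
        using abec abcd finR card_Suc_Diff1[of "comp_edges R w" "{a, b}"]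
          card_Suc_Diff1[of "comp_edges R w - {{a, b}}" "{c, d}"] by (simp add: comp_size_def)
    qed
    finally show False using le by simp
  qed
qed

text \<open>The conclusion says that the component contains a cycle. If it were a tree, the previous
  lemma would apply, with \<open>x1\<close> and \<open>x2\<close> ordered by the part into which the
  red edge \<open>{a, b}\<close> leads.\<close>

lemma two_isolated_children:
  assumes bad: "\<forall>B. span_forest B \<longrightarrow> (\<exists>v. 3 \<le> comp_size (E - B) v)"
    and min: "minstate B ys"
    and k: "0 < k" "k < i1" "k < i2" "i1 < length ys" "i2 < length ys" "i1 \<noteq> i2"
    and x1: "con (E - B) (ys ! k) x1" and o1: "parent B (hd ys) x1 (ys ! i1)"
    and x2: "con (E - B) (ys ! k) x2" and o2: "parent B (hd ys) x2 (ys ! i2)"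
    and y0: "comp_size (E - B) (ys ! i1) = 0" "comp_size (E - B) (ys ! i2) = 0"
    and big: "2 \<le> comp_size (E - B) (ys ! k)"
  shows "card (conn_comp (E - B) (ys ! k)) \<le> comp_size (E - B) (ys ! k)"
proof (rule ccontr)
  assume "\<not> ?thesis"
  then have span_forest: "comp_size (E - B) (ys ! k) + 1 \<le> card (conn_comp (E - B) (ys ! k))" by simp
  define B0 where "B0 = B - {{x1, ys ! i1}} - {{x2, ys ! i2}}"
  have B0': "B0 = B - {{x2, ys ! i2}} - {{x1, ys ! i1}}" by (auto simp: B0_def)
  have st: "span_forest B" "legal B ys" using min by (auto simp: minstate_def state_def)
  have ne: "{x1, ys ! i1} \<noteq> {x2, ys ! i2}"
  proof
    assume "{x1, ys ! i1} = {x2, ys ! i2}"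
    then consider "ys ! i1 = ys ! i2" | "x1 = ys ! i2" by (auto simp: doubleton_eq_iff)
    then show False
    proof cases
      case 1
      then show ?thesis
        using legal_disjoint[OF st(2) k(4,5,6)] self_in_comp[of "ys ! i2" "E - B"] by auto
    next
      case 2
      then have "ys ! i2 \<in> conn_comp (E - B) (ys ! k)" using x1 by (simp add: conn_comp_def)
      moreover have "conn_comp (E - B) (ys ! i2) \<inter> conn_comp (E - B) (ys ! k) = {}"
        by (rule legal_disjoint[OF st(2)]) (use k in auto)
      ultimately show ?thesis using self_in_comp[of "ys ! i2" "E - B"] by blast
    qed
  qed
  have "\<not> con B0 x1 (hd ys)"
    using o1 con_mono[of B0 x1 "hd ys" "B - {{x1, ys ! i1}}"] unfolding parent_def B0_def by blast
  then have "\<exists>j\<le>k. (\<exists>u\<in>conn_comp (E - B) (ys ! j). \<not> con B0 u (hd ys)) \<and>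
      (\<forall>i<j. \<not> (\<exists>u\<in>conn_comp (E - B) (ys ! i). \<not> con B0 u (hd ys)))"
    by (intro ex_least_index) (use x1 in \<open>auto simp: conn_comp_def\<close>)
  then obtain j v where j: "j \<le> k" "v \<in> conn_comp (E - B) (ys ! j)" "\<not> con B0 v (hd ys)"
    and rest: "\<And>i u. i < j \<Longrightarrow> u \<in> conn_comp (E - B) (ys ! i) \<Longrightarrow> con B0 u (hd ys)"
    by auto
  have jl: "j < length ys" using j k by auto
  have wr: "con B0 (ys ! j) (hd ys)"
    by (rule min_entry[OF min _ jl rest]) (auto simp: B0_def)
  from con_cross[OF con_in_comp_edges[OF j(2)], of "{u. con B0 u (hd ys)}"] wr j(3)
  obtain a b where ab: "{a, b} \<in> comp_edges (E - B) (ys ! j)" "con B0 a (hd ys)" "\<not> con B0 b (hd ys)" by auto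
  have "con (E - B) (ys ! j) b" using ab(1) by (auto simp: comp_edges_def conn_comp_def)
  then have "con E (ys ! j) b" by (rule con_mono) auto
  then have "con E (hd ys) b" using legal_con[OF st jl] con_trans by metis
  from two_cut_cover[OF st(1) o1 o2 ne this] ab(3) have "con B0 b x1 \<or> con B0 b x2"
    by (simp add: B0_def)
  then show False
  proof
    assume bx: "con B0 b x1"
    show False
      by (rule two_isolated_children_aux[OF bad min k x1 o1 x2 o2 y0 span_forest big B0_def j(1) _ ab(1,2) bx]) (fact rest)
  next
    assume bx: "con B0 b x2"
    show False
      by (rule two_isolated_children_aux[OF bad min k(1,3,2,5,4) k(6)[symmetric] x2 o2 x1 o1 y0(2,1)
          span_forest big B0' j(1) _ ab(1,2) bx]) (fact rest)
  qed
qed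

section \<open>Decomposing sparse graphs\<close>

lemma comp_edges_disjoint:
  assumes "F \<subseteq> E" "conn_comp F u \<inter> conn_comp F v = {}"
  shows "comp_edges F u \<inter> comp_edges F v = {}"
proof -
  have "f = {}" if "f \<in> comp_edges F u" "f \<in> comp_edges F v" for f
    using that assms(2) unfolding comp_edges_def by blast
  moreover have "{} \<notin> comp_edges F u" using empty_notin[OF assms(1)] by (simp add: comp_edges_def)
  ultimately show ?thesis by blast
qed

theorem sparse_decomposition:
  assumes sparse: "\<And>H. H \<subseteq> V \<Longrightarrow> 2 \<le> card H \<Longrightarrow> (\<And>u v. u \<in> H \<Longrightarrow> v \<in> H \<Longrightarrow> con {e\<in>E. e \<subseteq> H} u v) \<Longrightarrow>
    2 * card {e\<in>E. e \<subseteq> H} + 4 \<le> 3 * card H"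
  shows "\<exists>B. span_forest B \<and> (\<forall>v. comp_size (E - B) v \<le> 2)"
proof (rule ccontr)
  assume no: "\<not> ?thesis"
  have bad: "\<forall>B. span_forest B \<longrightarrow> (\<exists>v. 3 \<le> comp_size (E - B) v)"
  proof (intro allI impI)
    fix B assume "span_forest B"
    with no obtain v where "\<not> comp_size (E - B) v \<le> 2" by blast
    then show "\<exists>v. 3 \<le> comp_size (E - B) v" by (intro exI[of _ v]) simp
  qed
  obtain B1 where B1: "span_forest B1" using ex_span_forest by blast
  then obtain v1 where "3 \<le> comp_size (E - B1) v1" using bad by blast
  then have "state B1 [v1]" using B1 by (simp add: state_def legal_def)
  then obtain B ys where min: "minstate B ys" using ex_minstate by blast
  define R where "R = E - B"
  define r where "r = hd ys"
  define n where "n = length ys"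
  define X where "X i = conn_comp R (ys ! i)" for i
  define s where "s i = comp_size R (ys ! i)" for i
  have st: "span_forest B" "legal B ys" "3 \<le> comp_size R r" "ys \<noteq> []"
    using min by (auto simp: minstate_def state_def legal_def R_def r_def)
  have BE: "B \<subseteq> E" and RE: "R \<subseteq> E" using span_forest_sub[OF st(1)] by (auto simp: R_def)
  have finB: "finite B" and finR: "finite R" using BE RE finE finite_subset by blast+
  have r0: "r = ys ! 0" using st by (simp add: r_def hd_conv_nth)
  have n0: "0 < n" using st by (simp add: n_def)
  have rV: "r \<in> V" using bad_in_V[OF st(3) RE] .
  have disj: "X p \<inter> X q = {}" if "p < n" "q < n" "p \<noteq> q" for p q
    using legal_disjoint[OF st(2)] that by (simp add: R_def X_def n_def)
  define H where "H = (\<Union>i<n. X i)"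
  have conE: "con E r u" if "u \<in> H" for u
  proof -
    from that obtain i where i: "i < n" "con R (ys ! i) u" by (auto simp: H_def X_def conn_comp_def)
    have "con E r (ys ! i)" using legal_con[OF st(1,2), of i] i(1) by (simp add: n_def r_def)
    then show ?thesis by (rule con_trans[OF _ con_mono[OF i(2) RE]])
  qed
  have HV: "H \<subseteq> V" using con_in_V[OF conE _ rV] by auto
  have finH: "finite H" using HV finV finite_subset by auto
  have finX: "finite (X i)" if "i < n" for i
    using finH that by (auto simp: H_def intro: finite_subset)
  have rH: "r \<in> H" using n0 r0 self_in_comp[of r R] by (auto simp: H_def X_def intro!: bexI[of _ 0])
  have XH: "X i \<subseteq> H" if "i < n" for i using that by (auto simp: H_def)
  have ysH: "ys ! i \<in> H" if "i < n" for i
    using XH[OF that] self_in_comp[of "ys ! i" R] by (auto simp: X_def)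
  have closed: "y \<in> H" if x: "x \<in> H" "parent B r x y" for x y
  proof -
    from x(1) obtain i where i: "i < length ys" "con (E - B) (ys ! i) x"
      by (auto simp: H_def X_def conn_comp_def n_def R_def)
    from min_closed[OF min i x(2)[unfolded r_def]] show ?thesis
      by (auto simp: H_def X_def conn_comp_def n_def R_def)
  qed
  define EH where "EH = {e\<in>E. e \<subseteq> H}"
  have ecEH: "comp_edges R (ys ! i) \<subseteq> EH" if "i < n" for i
    using that RE by (auto simp: comp_edges_def EH_def H_def X_def)
  have inX: "con EH (ys ! i) u" if "i < n" "u \<in> X i" for i u
    by (rule con_mono[OF con_in_comp_edges ecEH[OF that(1)]]) (use that in \<open>simp add: X_def\<close>)
  have toroot: "con EH (ys ! i) r" if "i < n" for i
    using that
  proof (induction i rule: less_induct)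
    case (less i)
    show ?case
    proof (cases "i = 0")
      case False
      then obtain j x where jx: "j < i" "con (E - B) (ys ! j) x" "parent B (hd ys) x (ys ! i)"
        using st(2) less.prems unfolding legal_def n_def by blast
      then have x: "x \<in> X j" by (simp add: X_def conn_comp_def R_def)
      have jn: "j < n" using jx less.prems by simp
      have "con EH x (ys ! j)" by (rule con_sym[OF inX[OF jn x]])
      moreover have "{x, ys ! i} \<in> EH"
        using parent_edge[OF st(1) jx(3)] x XH[OF jn] ysH[OF less.prems] by (auto simp: EH_def)
      then have "con EH (ys ! i) x" by (metis con_edge con_sym)
      ultimately show ?thesis using less.IH[OF jx(1) jn] by (meson con_trans)
    qed (simp add: r0)
  qed
  have conH: "con EH u r" if "u \<in> H" for u
  proof -
    from that obtain i where i: "i < n" "u \<in> X i" by (auto simp: H_def)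
    show ?thesis by (rule con_trans[OF con_sym[OF inX[OF i]] toroot[OF i(1)]])
  qed
  have "2 \<le> card H"
  proof -
    have "comp_edges R r \<noteq> {}" using st(3) by (auto simp: comp_size_def)
    then obtain f where f: "f \<in> R" "f \<subseteq> X 0" by (auto simp: comp_edges_def X_def r0)
    then have "f \<subseteq> H" "card f = 2" using n0 RE edge by (auto simp: H_def)
    then show ?thesis using card_mono[OF finH] by metis
  qed
  then have sp: "2 * card EH + 4 \<le> 3 * card H"
    unfolding EH_def
    by (rule sparse[OF HV]) (rule con_trans[OF conH[unfolded EH_def] con_sym[OF conH[unfolded EH_def]]])
  \<comment> \<open>\<open>H\<close> is closed under parents, so each of its vertices other than
    \<open>r\<close> contributes its own parent edge: at least \<open>card H - 1\<close> blue edges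
    lie in \<open>H\<close>.\<close>
  define p where "p v = (SOME y. parent B r v y)" for v
  have p: "parent B r v (p v)" if "v \<in> H - {r}" for v
    unfolding p_def by (rule someI_ex, rule ex_parent) (use st conE that in auto)
  have "card (H - {r}) \<le> card {e\<in>B. e \<subseteq> H}"
  proof (rule card_inj_on_le)
    show "inj_on (\<lambda>v. {v, p v}) (H - {r})"
    proof (rule inj_onI, rule ccontr)
      fix u v assume uv: "u \<in> H - {r}" "v \<in> H - {r}" "{u, p u} = {v, p v}" "u \<noteq> v"
      then have "u = p v" "v = p u" by (auto simp: doubleton_eq_iff)
      then show False using parent_antisym[OF st(1) p[OF uv(1)]] p[OF uv(2)] by simp
    qed
    show "(\<lambda>v. {v, p v}) ` (H - {r}) \<subseteq> {e\<in>B. e \<subseteq> H}"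
      using p closed parent_edge[OF st(1) p] by blast
  qed (use finB in auto)
  then have blue: "card H \<le> card {e\<in>B. e \<subseteq> H} + 1" using rH finH by (simp add: card_Diff_singleton)
  have "card (\<Union>i<n. comp_edges R (ys ! i)) = (\<Sum>i<n. s i)"
    unfolding s_def comp_size_def
    by (rule card_UN_disjoint) (use finR comp_edges_disjoint[OF RE] disj in \<open>auto simp: X_def\<close>)
  moreover have "card ({e\<in>B. e \<subseteq> H} \<union> (\<Union>i<n. comp_edges R (ys ! i))) =
      card {e\<in>B. e \<subseteq> H} + card (\<Union>i<n. comp_edges R (ys ! i))"
    by (rule card_Un_disjoint) (use finB finR in \<open>auto simp: comp_edges_def R_def\<close>)
  moreover have "card ({e\<in>B. e \<subseteq> H} \<union> (\<Union>i<n. comp_edges R (ys ! i))) \<le> card EH"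
    using ecEH BE finE by (intro card_mono) (auto simp: EH_def)
  \<comment> \<open>Blue and red edges together give
    \<open>card H + (\<Sum>i<n. s i) \<le> card EH + 1\<close>, to be combined with
    \<open>sp\<close>. The rest of the proof contradicts this by
    \<open>card H \<le> 2 * (\<Sum>i<n. s i) + 1\<close>.\<close>
  ultimately have dens: "2 * (\<Sum>i<n. s i) + 2 \<le> card H" using sp blue by linarith
  have cardH: "card H = (\<Sum>i<n. card (X i))"
    unfolding H_def by (rule card_UN_disjoint) (use finX disj in auto)
  define Z where "Z = {i. i < n \<and> s i = 0}"
  have finZ: "finite Z" by (simp add: Z_def)
  have "\<forall>i\<in>Z. \<exists>k x. k < i \<and> con R (ys ! k) x \<and> parent B r x (ys ! i)"
  proof
    fix i assume i: "i \<in> Z"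
    then have "i \<noteq> 0" using st(3) r0 by (auto simp: Z_def s_def intro!: gr0I)
    then show "\<exists>k x. k < i \<and> con R (ys ! k) x \<and> parent B r x (ys ! i)"
      using st(2) i unfolding legal_def R_def r_def Z_def n_def by auto
  qed
  \<comment> \<open>The isolated component \<open>i\<close> is charged to the component
    \<open>kk i\<close> from which it is entered, by the parent edge of \<open>xx i\<close>.\<close>
  then obtain kk xx where par: "\<And>i. i \<in> Z \<Longrightarrow> kk i < i \<and> con R (ys ! kk i) (xx i) \<and> parent B r (xx i) (ys ! i)"
    by metis
  define z where "z k = card {i\<in>Z. kk i = k}" for k
  have sumz: "(\<Sum>k<n. z k) = card Z"
    using sum.group[of Z "{..<n}" kk "\<lambda>_. 1::nat"] finZ par unfolding z_def
    by (force simp: Z_def)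
  have sum0: "(\<Sum>k<n. if s k = 0 then 1 else 0) = card Z"
    by (simp add: Z_def sum.If_cases Int_def)
  \<comment> \<open>A vertex has only one parent, so the isolated components entered from
    \<open>X k\<close> use different vertices of it, none of them the root. This bounds
    \<open>z k\<close>.\<close>
  have injx: "inj_on xx Z"
  proof (rule inj_onI, rule ccontr)
    fix i j assume ij: "i \<in> Z" "j \<in> Z" "xx i = xx j" "i \<noteq> j"
    then have "ys ! i = ys ! j" using par parent_unique[OF st(1)] by metis
    then have "ys ! i \<in> X i \<inter> X j" by (simp add: X_def)
    then show False using disj[of i j] ij by (auto simp: Z_def)
  qed
  have zX: "z k \<le> card (X k - {r})" if "k < n" for k
    unfolding z_def
  proof (rule card_inj_on_le[of xx])
    show "inj_on xx {i\<in>Z. kk i = k}" using injx by (rule inj_on_subset) auto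
    show "xx ` {i\<in>Z. kk i = k} \<subseteq> X k - {r}"
      using par no_parent_root by (auto simp: X_def conn_comp_def)
  qed (use finX that in simp)
  have iso: "2 \<le> s (kk i)" if "i \<in> Z" for i
  proof -
    have "con (E - B) (ys ! kk i) (xx i)" "parent B (hd ys) (xx i) (ys ! i)" "kk i < i" "i < length ys"
      "comp_size (E - B) (ys ! i) = 0"
      using par[OF that] that by (auto simp: R_def r_def Z_def n_def s_def)
    then show ?thesis unfolding s_def R_def using isolated_child[OF bad min] by blast
  qed
  have two: "card (X k) \<le> s k" if "0 < k" "i \<in> Z" "j \<in> Z" "i \<noteq> j" "kk i = k" "kk j = k" for k i j
  proof -
    have *: "con (E - B) (ys ! kk i) (xx i)" "parent B (hd ys) (xx i) (ys ! i)" "kk i < i" "i < length ys"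
      "comp_size (E - B) (ys ! i) = 0" if "i \<in> Z" for i
      using par[OF that] that by (auto simp: R_def r_def Z_def n_def s_def)
    show ?thesis
      using two_isolated_children[OF bad min that(1), of i j "xx i" "xx j"] *[OF that(2)] *[OF that(3)]
        that iso[OF that(2)] unfolding X_def s_def R_def by simp
  qed
  \<comment> \<open>Component \<open>k\<close> pays for the isolated ones entered from it. An
    isolated component receives the unit for \<open>s k = 0\<close>. The root component may
    overspend by one, as \<open>two_isolated_children\<close> does not cover it: only
    \<open>card (X 0) \<le> s 0 + 1\<close> and \<open>z 0 \<le> card (X 0) - 1\<close> are known
    there.\<close>
  have claim: "card (X k) + z k \<le> 2 * s k + (if k = 0 then 1 else 0) + (if s k = 0 then 1 else 0)"
    if k: "k < n" for k
  proof -
    have Xs: "card (X k) \<le> s k + 1"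
      unfolding X_def s_def by (rule card_comp_le) (use finR finX[OF k] in \<open>auto simp: X_def\<close>)
    have z0: "z k = 0" if "s k \<le> 1"
    proof -
      have "{i\<in>Z. kk i = k} = {}" using iso that by fastforce
      then show ?thesis by (simp only: z_def card.empty)
    qed
    consider "s k = 0" | "s k = 1" | "2 \<le> s k" "k = 0" | "2 \<le> s k" "0 < k" "z k \<le> 1"
      | "2 \<le> s k" "0 < k" "2 \<le> z k" by linarith
    then show ?thesis
    proof cases
      case 3
      have "r \<in> X k" using 3 r0 by (simp add: X_def)
      then have "z k \<le> card (X k) - 1" using zX[OF k] finX[OF k] by simp
      then show ?thesis using 3 Xs by simp
    next
      case 5
      then obtain D where "D \<subseteq> {i\<in>Z. kk i = k}" "card D = 2"
        unfolding z_def by (meson obtain_subset_with_card_n)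
      then obtain i j where "i \<in> Z" "j \<in> Z" "i \<noteq> j" "kk i = k" "kk j = k"
        by (auto simp: card_2_iff)
      then have "card (X k) \<le> s k" using two 5(2) by blast
      moreover have "z k \<le> card (X k)"
        using zX[OF k] finX[OF k] card_mono[of "X k" "X k - {r}"] by auto
      ultimately show ?thesis by simp
    qed (use Xs z0 in auto)
  qed
  have "(\<Sum>k<n. card (X k) + z k) \<le>
      (\<Sum>k<n. 2 * s k + (if k = 0 then 1 else 0) + (if s k = 0 then 1 else 0))"
    by (rule sum_mono) (use claim in auto)
  also have "\<dots> = 2 * (\<Sum>k<n. s k) + 1 + card Z"
    using n0 sum0 by (simp add: sum.distrib sum_distrib_left)
  finally have "card H \<le> 2 * (\<Sum>k<n. s k) + 1"
    by (simp add: sum.distrib sumz cardH)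
  then show False using dens by simp
qed

end

section \<open>Faces of a plane drawing\<close>

text \<open>Disjoint nonempty open connected sets with union an open set are its components. As
  \<open>P\<close> meets \<open>S\<close> only inside \<open>U\<close>, the other components stay
  and \<open>T\<close> takes the place of \<open>U\<close>.\<close>

lemma components_replace:
  fixes S :: "'a::real_normed_vector set"
  assumes "open S" "U \<in> components S" "S \<inter> P \<subseteq> U" "\<Union>T = U - P" "pairwise disjnt T"
    "\<And>X. X \<in> T \<Longrightarrow> open X \<and> connected X \<and> X \<noteq> {}"
  shows "components (S - P) = (components S - {U}) \<union> T"
proof (rule components_open_unique)
  have dU: "X \<inter> U = {}" if "X \<in> components S - {U}" for X
    using components_nonoverlap[of X S U] that assms(2) by auto
  have TU: "X \<subseteq> U" if "X \<in> T" for X using that assms(4) by auto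
  show "pairwise disjnt (components S - {U} \<union> T)"
    unfolding pairwise_def disjnt_def
  proof (intro ballI impI)
    fix X Y assume XY: "X \<in> components S - {U} \<union> T" "Y \<in> components S - {U} \<union> T" "X \<noteq> Y"
    consider "X \<in> components S - {U}" "Y \<in> components S - {U}" | "X \<in> components S - {U}" "Y \<in> T"
      | "X \<in> T" "Y \<in> components S - {U}" | "X \<in> T" "Y \<in> T" using XY by blast
    then show "X \<inter> Y = {}"
    proof cases
      case 1 then show ?thesis using components_nonoverlap[of X S Y] XY(3) by auto
    next
      case 2 then show ?thesis using dU TU by blast
    next
      case 3 then show ?thesis using dU TU by blast
    next
      case 4 then show ?thesis using assms(5) XY(3) by (auto simp: pairwise_def disjnt_def)
    qed
  qed
  have "\<Union>(components S - {U}) = S - U"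
    using dU Union_components[of S] assms(2) by blast
  then show "\<Union>(components S - {U} \<union> T) = S - P"
    using assms(3,4) in_components_subset[OF assms(2)] by auto
  show "open X \<and> connected X \<and> X \<noteq> {}" if "X \<in> components S - {U} \<union> T" for X
    using that assms(6) open_components[OF assms(1)] in_components_connected in_components_nonempty
    by blast
qed

text \<open>\<open>J\<close> is meant to be a side of a Jordan curve \<open>C\<close>. Points of
  \<open>U \<inter> J\<close> are separated neither by \<open>C\<close> nor by \<open>D\<close>; as
  \<open>C \<inter> D\<close> is connected, Janiszewski's theorem joins them outside
  \<open>C \<union> D\<close>, and maximality of \<open>U\<close> and \<open>J\<close> keeps the
  joining set in both.\<close>

lemma connected_cut:
  fixes U :: "complex set"
  assumes U: "U \<in> components (- D)" and D: "closed D" and C: "compact C" and CD: "connected (C \<inter> D)"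
    and J: "connected J" "J \<subseteq> - C" "\<And>Q. connected Q \<Longrightarrow> Q \<subseteq> - C \<Longrightarrow> Q \<inter> J \<noteq> {} \<Longrightarrow> Q \<subseteq> J"
  shows "connected (U \<inter> J)"
  unfolding connected_iff_connected_component
proof (intro ballI)
  fix z z' assume z: "z \<in> U \<inter> J" "z' \<in> U \<inter> J"
  have "connected_component (- C) z z'"
    using z J by (auto simp: connected_component_def)
  moreover have "connected_component (- D) z z'"
    using z in_components_connected[OF U] in_components_subset[OF U] by (auto simp: connected_component_def)
  ultimately have "connected_component (- (C \<union> D)) z z'"
    by (rule Janiszewski[OF C D CD])
  then obtain Q where Q: "connected Q" "Q \<subseteq> - (C \<union> D)" "z \<in> Q" "z' \<in> Q"
    by (auto simp: connected_component_def)
  have "Q \<subseteq> U" by (rule components_maximal[OF U Q(1)]) (use Q z in auto)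
  moreover have "Q \<subseteq> J" using Q z by (intro J(3)) auto
  ultimately show "connected_component (U \<inter> J) z z'"
    using Q by (auto simp: connected_component_def)
qed

locale plane_graph = finite_graph V E for V :: "'a set" and E +
  fixes p :: "'a \<Rightarrow> complex" and \<gamma> :: "'a set \<Rightarrow> real \<Rightarrow> complex"
  assumes inj: "inj_on p V"
    and arcs: "\<And>e. e \<in> E \<Longrightarrow> arc (\<gamma> e)"
    and ends: "\<And>e. e \<in> E \<Longrightarrow> {pathstart (\<gamma> e), pathfinish (\<gamma> e)} = p ` e"
    and vert: "\<And>e v. e \<in> E \<Longrightarrow> v \<in> V \<Longrightarrow> p v \<in> path_image (\<gamma> e) \<Longrightarrow> v \<in> e"
    and cross: "\<And>e f. e \<in> E \<Longrightarrow> f \<in> E \<Longrightarrow> e \<noteq> f \<Longrightarrow> path_image (\<gamma> e) \<inter> path_image (\<gamma> f) \<subseteq> p ` (e \<inter> f)"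
begin

text \<open>All vertices are drawn, whatever \<open>F\<close> is, so that a new edge meets the old
  drawing exactly in its two ends.\<close>

definition drawing :: "'a set set \<Rightarrow> complex set" where
  "drawing F = p ` V \<union> (\<Union>e\<in>F. path_image (\<gamma> e))"

definition open_arc :: "'a set \<Rightarrow> complex set" where
  "open_arc e = path_image (\<gamma> e) - p ` e"

abbreviation faces :: "'a set set \<Rightarrow> complex set set" where
  "faces F \<equiv> components (- drawing F)"

lemma drawing_insert: "drawing (insert e F) = drawing F \<union> path_image (\<gamma> e)"
  by (auto simp: drawing_def)

lemma compact_part: "F \<subseteq> E \<Longrightarrow> A \<subseteq> V \<Longrightarrow> compact (p ` A \<union> (\<Union>e\<in>F. path_image (\<gamma> e)))"
proof (rule compact_Un)
  assume F: "F \<subseteq> E" "A \<subseteq> V"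
  have "finite A" using F(2) finV finite_subset by auto
  then show "compact (p ` A)" by (intro finite_imp_compact finite_imageI)
  have "finite F" using F(1) finE finite_subset by auto
  then show "compact (\<Union>e\<in>F. path_image (\<gamma> e))"
    by (rule compact_UN) (use F(1) arcs compact_arc_image in blast)
qed

lemma compact_drawing: "F \<subseteq> E \<Longrightarrow> compact (drawing F)"
  unfolding drawing_def by (rule compact_part) auto

lemma closed_drawing: "F \<subseteq> E \<Longrightarrow> closed (drawing F)"
  by (simp add: compact_drawing compact_imp_closed)

lemma ends_in: "e \<in> E \<Longrightarrow> p ` e \<subseteq> path_image (\<gamma> e)"
  using ends by (metis insert_subset pathfinish_in_path_image pathstart_in_path_image empty_subsetI)

lemma drawing_Int:
  assumes "F \<subseteq> E" "e \<in> E" "e \<notin> F"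
  shows "drawing F \<inter> path_image (\<gamma> e) = p ` e"
proof
  show "p ` e \<subseteq> drawing F \<inter> path_image (\<gamma> e)"
    using ends_in[OF assms(2)] edge[OF assms(2)] by (auto simp: drawing_def)
  have "path_image (\<gamma> f) \<inter> path_image (\<gamma> e) \<subseteq> p ` e" if "f \<in> F" for f
    using cross[of f e] that assms by auto
  moreover have "p ` V \<inter> path_image (\<gamma> e) \<subseteq> p ` e" using vert assms(2) by auto
  ultimately show "drawing F \<inter> path_image (\<gamma> e) \<subseteq> p ` e" by (auto simp: drawing_def)
qed

lemma open_arc_conv: "e \<in> E \<Longrightarrow> open_arc e = path_image (\<gamma> e) - {pathstart (\<gamma> e), pathfinish (\<gamma> e)}"
  using ends by (simp add: open_arc_def)

lemma connected_open_arc: "e \<in> E \<Longrightarrow> connected (open_arc e)"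
  unfolding open_arc_conv
  by (rule connected_simple_path_endless, rule arc_imp_simple_path, rule arcs)

lemma open_arc_nonempty: "e \<in> E \<Longrightarrow> open_arc e \<noteq> {}"
  unfolding open_arc_conv
  by (rule nonempty_simple_path_endless, rule arc_imp_simple_path, rule arcs)

lemma open_arc_disjoint: "F \<subseteq> E \<Longrightarrow> e \<in> E \<Longrightarrow> e \<notin> F \<Longrightarrow> open_arc e \<inter> drawing F = {}"
  using drawing_Int unfolding open_arc_def by blast

lemma con_path_component:
  assumes "con F u v" "F \<subseteq> E" "u \<in> V"
  shows "path_component (drawing F) (p u) (p v)"
  using assms(1)
proof (induction rule: con_induct)
  case refl
  show ?case using assms(3) by (auto simp: drawing_def intro: path_component_refl)
next
  case (step a b)
  have e: "{a, b} \<in> E" using step assms by auto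
  have "p a \<in> path_image (\<gamma> {a, b})" "p b \<in> path_image (\<gamma> {a, b})" using ends_in[OF e] by auto
  moreover have "path_connected (path_image (\<gamma> {a, b}))"
    using arcs[OF e] arc_imp_path path_connected_path_image by blast
  ultimately have "path_component (path_image (\<gamma> {a, b})) (p a) (p b)"
    by (simp add: path_connected_component)
  then have "path_component (drawing F) (p a) (p b)"
    by (rule path_component_of_subset[rotated]) (use step in \<open>auto simp: drawing_def\<close>)
  then show ?case using step.IH by (rule path_component_trans[rotated])
qed

lemma face_of_edge:
  assumes "F \<subseteq> E" "e \<in> E" "e \<notin> F"
  shows "\<exists>U\<in>faces F. open_arc e \<subseteq> U"
  using exists_component_superset[of "open_arc e" "- drawing F"] connected_open_arc[OF assms(2)]
    open_arc_disjoint[OF assms] open_arc_nonempty[OF assms(2)] by blast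

lemma face_Int_arc:
  assumes "F \<subseteq> E" "e \<in> E" "e \<notin> F" "U \<in> faces F" "open_arc e \<subseteq> U"
  shows "- drawing F \<inter> path_image (\<gamma> e) \<subseteq> U"
  using drawing_Int[OF assms(1-3)] assms(5) unfolding open_arc_def by blast

text \<open>The edge closes a Jordan curve \<open>C\<close> with an arc in the drawing. As \<open>C\<close> meets the drawing in that arc
  only, Janiszewski's theorem shows that both sides of \<open>C\<close> cut the face in a connected set.\<close>

lemma add_cycle_edge:
  assumes F: "F \<subseteq> E" and e: "{a, b} \<in> E" "{a, b} \<notin> F" and con: "con F a b"
    and U: "U \<in> faces F" "open_arc {a, b} \<subseteq> U"
  shows "\<exists>T. finite T \<and> card T = 2 \<and> \<Union>T \<subseteq> U \<and> {} \<notin> T \<and> faces (insert {a, b} F) = (faces F - {U}) \<union> T"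
proof -
  define g where "g = \<gamma> {a, b}"
  define s where "s = pathstart g"
  define t where "t = pathfinish g"
  have arcg: "arc g" using arcs[OF e(1)] by (simp add: g_def)
  have st: "{s, t} = {p a, p b}" using ends[OF e(1)] by (simp add: s_def t_def g_def)
  have aV: "a \<in> V" using edgeD[OF e(1)] by simp
  have pc: "path_component (drawing F) t s"
    using con_path_component[OF con F aV] st path_component_sym by (auto simp: doubleton_eq_iff)
  have ne: "t \<noteq> s" using arcg arc_distinct_ends by (force simp: s_def t_def)
  define Q where "Q = path_component_set (drawing F) t"
  have "path_connected Q" "t \<in> Q" "s \<in> Q"
    using pc path_component_refl[of t "drawing F"] path_component_mem[OF pc] by (auto simp: Q_def)
  then obtain h where h: "arc h" "path_image h \<subseteq> Q" "pathstart h = t" "pathfinish h = s"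
    using ne path_connected_arcwise by blast
  have hD: "path_image h \<subseteq> drawing F"
    using h(2) path_component_subset unfolding Q_def by blast
  have gD: "drawing F \<inter> path_image g = {s, t}"
    using drawing_Int[OF F e] st by (simp add: g_def)
  have "path_image g \<inter> path_image h \<subseteq> {s, t}" using gD hD by auto
  then have loop: "simple_path (g +++ h)"
    by (intro simple_path_join_loop) (use arcg h in \<open>auto simp: s_def t_def\<close>)
  define C where "C = path_image (g +++ h)"
  have C: "C = path_image g \<union> path_image h"
    unfolding C_def by (rule path_image_join) (simp add: h t_def)
  have "pathfinish (g +++ h) = pathstart (g +++ h)" by (simp add: h s_def)
  note J = Jordan_inside_outside[OF loop this, folded C_def]
  have cC: "compact C" unfolding C_def using loop by (rule compact_simple_path_image)
  have "s \<in> path_image h" "t \<in> path_image h"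
    using h(3,4) by (metis pathfinish_in_path_image pathstart_in_path_image)+
  then have CD: "C \<inter> drawing F = path_image h" using C gD hD by auto
  then have conCD: "connected (C \<inter> drawing F)"
    using h(1) by (simp add: connected_arc_image)
  have oU: "open U" using open_components U(1) closed_drawing[OF F] by blast
  have UD: "U \<subseteq> - drawing F" using in_components_subset U(1) by blast
  have split: "Q \<subseteq> inside C \<or> Q \<subseteq> outside C" if "connected Q" "Q \<subseteq> - C" for Q
    using connectedD[OF that(1), of "inside C" "outside C"] J that(2) by blast
  have dIO: "inside C \<inter> outside C = {}" "inside C \<union> outside C = - C" using J by auto
  have cI: "connected (U \<inter> inside C)"
  proof (rule connected_cut[OF U(1) closed_drawing[OF F] cC conCD])
    show "connected (inside C)" using J by simp
    show "inside C \<subseteq> - C" using dIO by blast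
    show "Q \<subseteq> inside C" if "connected Q" "Q \<subseteq> - C" "Q \<inter> inside C \<noteq> {}" for Q
      using split[OF that(1,2)] that(3) dIO(1) by blast
  qed
  have cO: "connected (U \<inter> outside C)"
  proof (rule connected_cut[OF U(1) closed_drawing[OF F] cC conCD])
    show "connected (outside C)" using J by simp
    show "outside C \<subseteq> - C" using dIO by blast
    show "Q \<subseteq> outside C" if "connected Q" "Q \<subseteq> - C" "Q \<inter> outside C \<noteq> {}" for Q
      using split[OF that(1,2)] that(3) dIO(1) by blast
  qed
  \<comment> \<open>A point of the new arc lies in \<open>U\<close> and on the frontier of both
    sides of \<open>C\<close>, so the open set \<open>U\<close> meets both of them.\<close>
  obtain x where x: "x \<in> open_arc {a, b}" using open_arc_nonempty[OF e(1)] by auto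
  then have xU: "x \<in> U" and xC: "x \<in> C" using U(2) C by (auto simp: open_arc_def g_def)
  have "x \<in> closure (inside C)" "x \<in> closure (outside C)"
    using xC J by (auto simp: frontier_def)
  then have neI: "U \<inter> inside C \<noteq> {}" and neO: "U \<inter> outside C \<noteq> {}"
    using open_Int_closure_eq_empty[OF oU] xU by blast+
  define T where "T = {U \<inter> inside C, U \<inter> outside C}"
  have "components (- drawing F - path_image g) = (faces F - {U}) \<union> T"
  proof (rule components_replace)
    show "open (- drawing F)" using closed_drawing[OF F] by auto
    show "- drawing F \<inter> path_image g \<subseteq> U" using face_Int_arc[OF F e U] by (simp add: g_def)
    have "\<Union>T = U \<inter> - C" unfolding T_def dIO(2)[symmetric] by blast
    also have "\<dots> = U - path_image g" unfolding C using UD hD by blast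
    finally show "\<Union>T = U - path_image g" .
    show "pairwise disjnt T" unfolding T_def pairwise_def disjnt_def using dIO(1) by blast
    have "open (inside C)" "open (outside C)" using J by auto
    then show "open X \<and> connected X \<and> X \<noteq> {}" if "X \<in> T" for X
      using that cI cO neI neO oU unfolding T_def by blast
  qed (fact U)
  moreover have "- drawing F - path_image g = - drawing (insert {a, b} F)"
    by (auto simp: drawing_insert g_def)
  moreover have "U \<inter> inside C \<noteq> U \<inter> outside C" using dIO(1) neI by blast
  then have "card T = 2" by (simp add: T_def)
  moreover have "\<Union>T \<subseteq> U" "{} \<notin> T" "finite T" using neI neO by (auto simp: T_def)
  ultimately show ?thesis by auto
qed

text \<open>The drawing falls into the disjoint compact sets \<open>D1\<close>, the component of
  \<open>a\<close>, and \<open>D2\<close>, the rest. Janiszewski's theorem is applied twice, adding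
  \<open>D1\<close> and then \<open>D2\<close> to the new arc; the intersections are the single
  points \<open>p a\<close> and \<open>p b\<close>, hence connected, so the arc does not disconnect
  the face.\<close>

lemma add_bridge_edge:
  assumes F: "F \<subseteq> E" and e: "{a, b} \<in> E" "{a, b} \<notin> F" and con: "\<not> con F a b"
    and U: "U \<in> faces F" "open_arc {a, b} \<subseteq> U"
  shows "\<exists>T. finite T \<and> card T \<le> 1 \<and> \<Union>T \<subseteq> U \<and> faces (insert {a, b} F) = (faces F - {U}) \<union> T"
proof -
  define g where "g = \<gamma> {a, b}"
  have arcg: "arc g" using arcs[OF e(1)] by (simp add: g_def)
  have abV: "a \<in> V" "b \<in> V" "a \<noteq> b" using edgeD[OF e(1)] by auto
  have gD: "drawing F \<inter> path_image g = {p a, p b}"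
    using drawing_Int[OF F e] by (simp add: g_def)
  define A where "A = {v\<in>V. con F a v}"
  have aA: "a \<in> A" "b \<notin> A" using abV con by (auto simp: A_def)
  define D1 where "D1 = p ` A \<union> (\<Union>f\<in>{f\<in>F. f \<subseteq> A}. path_image (\<gamma> f))"
  define D2 where "D2 = p ` (V - A) \<union> (\<Union>f\<in>{f\<in>F. \<not> f \<subseteq> A}. path_image (\<gamma> f))"
  have fA: "f \<inter> A = {}" if f: "f \<in> F" "\<not> f \<subseteq> A" for f
  proof -
    obtain u v where uv: "f = {u, v}" using edge_obtain f(1) F by blast
    then have uvV: "u \<in> V" "v \<in> V" using edgeD[of u v] f(1) F by auto
    have "con F a u \<longleftrightarrow> con F a v"
      using comp_step[of u v F a] f(1) uv by (simp add: conn_comp_def)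
    then show ?thesis using f(2) uv uvV by (auto simp: A_def)
  qed
  have D12: "drawing F = D1 \<union> D2" by (auto simp: drawing_def D1_def D2_def A_def)
  have cD: "compact D1" "compact D2"
    unfolding D1_def D2_def by (rule compact_part; use F in \<open>auto simp: A_def\<close>)+
  have "p u \<notin> p ` (V - A)" if "u \<in> A" for u
    using inj_onD[OF inj, of u] that by (auto simp: A_def)
  moreover have "p u \<notin> path_image (\<gamma> f)" if "u \<in> A" "f \<in> F" "\<not> f \<subseteq> A" for u f
    using vert[of f u] fA[OF that(2,3)] that F by (auto simp: A_def)
  moreover have "p u \<notin> path_image (\<gamma> f)" if "u \<in> V - A" "f \<in> F" "f \<subseteq> A" for u f
    using vert[of f u] that F by auto
  moreover have "path_image (\<gamma> f) \<inter> path_image (\<gamma> f') = {}"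
    if "f \<in> F" "f \<subseteq> A" "f' \<in> F" "\<not> f' \<subseteq> A" for f f'
  proof -
    have "f \<inter> f' = {}" "f \<noteq> f'" using that fA by auto
    then show ?thesis using cross[of f f'] that F by auto
  qed
  ultimately have d12: "D1 \<inter> D2 = {}" unfolding D1_def D2_def by blast
  have paD1: "p a \<in> D1" and pbD2: "p b \<in> D2" using aA abV by (auto simp: D1_def D2_def)
  have i1: "path_image g \<inter> D1 = {p a}" using gD D12 d12 paD1 pbD2 by auto
  have i2: "(path_image g \<union> D1) \<inter> D2 = {p b}" using gD D12 d12 paD1 pbD2 by auto
  have cg: "compact (path_image g)" using arcg by (rule compact_arc_image)
  have UD: "U \<subseteq> - drawing F" using in_components_subset U(1) by blast
  have conn: "connected (U - path_image g)"
    unfolding connected_iff_connected_component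
  proof (intro ballI)
    fix z z' assume z: "z \<in> U - path_image g" "z' \<in> U - path_image g"
    have zD: "connected_component (- drawing F) z z'"
      using z in_components_connected[OF U(1)] UD by (auto simp: connected_component_def)
    have 1: "connected_component (- D1) z z'" and 2: "connected_component (- D2) z z'"
      using connected_component_of_subset[OF zD] D12 by auto
    have "connected (- path_image g)"
      by (rule connected_arc_complement[OF arcg]) simp
    then have "connected_component (- path_image g) z z'"
      using z by (auto simp: connected_iff_connected_component)
    then have "connected_component (- (path_image g \<union> D1)) z z'"
      using Janiszewski[OF cg compact_imp_closed[OF cD(1)] _ _ 1] i1 by simp
    then have "connected_component (- (path_image g \<union> D1 \<union> D2)) z z'"
      using Janiszewski[OF compact_Un[OF cg cD(1)] compact_imp_closed[OF cD(2)] _ _ 2] i2 by simp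
    then obtain Q where Q: "connected Q" "Q \<subseteq> - (path_image g \<union> D1 \<union> D2)" "z \<in> Q" "z' \<in> Q"
      by (auto simp: connected_component_def)
    have "Q \<subseteq> U" by (rule components_maximal[OF U(1) Q(1)]) (use Q z D12 in auto)
    then show "connected_component (U - path_image g) z z'"
      using Q unfolding connected_component_def by (intro exI[of _ Q]) auto
  qed
  define T where "T = {U - path_image g} - {{}}"
  have oU: "open U" using open_components U(1) closed_drawing[OF F] by blast
  have "components (- drawing F - path_image g) = (faces F - {U}) \<union> T"
  proof (rule components_replace)
    show "open (- drawing F)" using closed_drawing[OF F] by auto
    show "- drawing F \<inter> path_image g \<subseteq> U" using face_Int_arc[OF F e U] by (simp add: g_def)
    show "\<Union>T = U - path_image g" by (auto simp: T_def)
    show "pairwise disjnt T" by (auto simp: T_def pairwise_def)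
    show "open X \<and> connected X \<and> X \<noteq> {}" if "X \<in> T" for X
      using that conn oU cg compact_imp_closed by (auto simp: T_def)
  qed (fact U)
  moreover have "- drawing F - path_image g = - drawing (insert {a, b} F)"
    by (auto simp: drawing_insert g_def)
  moreover have "card T \<le> 1"
    unfolding T_def using card_Diff1_le[of "{U - path_image g}" "{}"] by simp
  ultimately show ?thesis by (intro exI[of _ T]) (auto simp: T_def)
qed

lemma faces_empty: "faces {} = {- drawing {}}"
proof (rule components_open_unique)
  have fin: "finite (p ` V)" using finV by simp
  have "connected (UNIV - p ` V)"
    by (rule connected_open_delete_finite) (use fin in auto)
  then have "connected (- drawing {})" by (simp add: drawing_def Compl_eq_Diff_UNIV)
  moreover have "- drawing {} \<noteq> {}"
  proof
    assume "- drawing {} = {}"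
    then have "p ` V = UNIV" unfolding drawing_def by blast
    then show False using fin infinite_UNIV_char_0[where 'a = complex] by simp
  qed
  moreover have "open (- drawing {})" using closed_drawing[of "{}"] by auto
  ultimately show "open X \<and> connected X \<and> X \<noteq> {}" if "X \<in> {- drawing {}}" for X
    using that by auto
qed auto

lemma add_edge:
  assumes "F \<subseteq> E" "e \<in> E" "e \<notin> F"
  shows "\<exists>U T. U \<in> faces F \<and> open_arc e \<subseteq> U \<and> finite T \<and> card T \<le> 2 \<and>
    faces (insert e F) = (faces F - {U}) \<union> T"
proof -
  obtain a b where ab: "e = {a, b}" using edge_obtain assms(2) by blast
  obtain U where U: "U \<in> faces F" "open_arc e \<subseteq> U" using face_of_edge[OF assms] by blast
  have "\<exists>T. finite T \<and> card T \<le> 2 \<and> faces (insert e F) = (faces F - {U}) \<union> T"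
  proof (cases "con F a b")
    case True
    from add_cycle_edge[OF assms[unfolded ab] True U[unfolded ab]] show ?thesis
      unfolding ab by (metis order_refl)
  next
    case False
    from add_bridge_edge[OF assms[unfolded ab] False U[unfolded ab]] obtain T where
      "finite T" "card T \<le> 1" "faces (insert e F) = (faces F - {U}) \<union> T"
      unfolding ab by blast
    then show ?thesis by (intro exI[of _ T]) simp
  qed
  then show ?thesis using U by blast
qed

lemma finite_faces: "F \<subseteq> E \<Longrightarrow> finite (faces F)"
proof -
  assume "F \<subseteq> E"
  then have "finite F" using finE finite_subset by auto
  then show ?thesis using \<open>F \<subseteq> E\<close>
  proof (induction F rule: finite_induct)
    case (insert e F)
    then have "F \<subseteq> E" "e \<in> E" by auto
    from add_edge[OF this insert.hyps(2)] obtain U T where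
      "finite T" "faces (insert e F) = (faces F - {U}) \<union> T" by blast
    then show ?case using insert.IH[OF \<open>F \<subseteq> E\<close>] by simp
  qed (simp add: faces_empty)
qed

lemma card_faces_cycle_edge:
  assumes "F \<subseteq> E" "{a, b} \<in> E" "{a, b} \<notin> F" "con F a b"
  shows "card (faces (insert {a, b} F)) = card (faces F) + 1"
proof -
  obtain U where U: "U \<in> faces F" "open_arc {a, b} \<subseteq> U" using face_of_edge[OF assms(1-3)] by blast
  from add_cycle_edge[OF assms U] obtain T where T:
    "finite T" "card T = 2" "\<Union>T \<subseteq> U" "{} \<notin> T" "faces (insert {a, b} F) = (faces F - {U}) \<union> T" by auto
  have "X \<notin> T" if "X \<in> faces F - {U}" for X
  proof
    assume "X \<in> T"
    then have "X \<subseteq> U" using T(3) by auto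
    moreover have "X \<inter> U = {}" using components_nonoverlap[of X _ U] that U(1) by auto
    ultimately show False using \<open>X \<in> T\<close> T(4) by (metis inf.absorb1)
  qed
  then have "card ((faces F - {U}) \<union> T) = card (faces F - {U}) + card T"
    using T(1) finite_faces[OF assms(1)] by (intro card_Un_disjoint) auto
  moreover have "card (faces F) > 0" using U(1) finite_faces[OF assms(1)] card_gt_0_iff by blast
  ultimately show ?thesis using T(2,5) U(1) finite_faces[OF assms(1)] by simp
qed

lemma card_faces_bridge_edge:
  assumes "F \<subseteq> E" "{a, b} \<in> E" "{a, b} \<notin> F" "\<not> con F a b"
  shows "card (faces (insert {a, b} F)) \<le> card (faces F)"
proof -
  obtain U where U: "U \<in> faces F" "open_arc {a, b} \<subseteq> U" using face_of_edge[OF assms(1-3)] by blast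
  from add_bridge_edge[OF assms U] obtain T where T:
    "finite T" "card T \<le> 1" "faces (insert {a, b} F) = (faces F - {U}) \<union> T" by auto
  have "card ((faces F - {U}) \<union> T) \<le> card (faces F - {U}) + card T" by (rule card_Un_le)
  moreover have "card (faces F) > 0" using U(1) finite_faces[OF assms(1)] card_gt_0_iff by blast
  ultimately show ?thesis using T(2,3) U(1) finite_faces[OF assms(1)] by simp
qed

lemma faces_nonempty: "F \<subseteq> E \<Longrightarrow> 1 \<le> card (faces F)"
proof -
  assume F: "F \<subseteq> E"
  have "drawing F \<noteq> UNIV"
    using compact_drawing[OF F] compact_imp_bounded not_bounded_UNIV by metis
  then have "faces F \<noteq> {}" using Union_components[of "- drawing F"] by auto
  then show ?thesis using finite_faces[OF F] by (simp add: Suc_leI card_gt_0_iff)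
qed

text \<open>The half of Euler's formula that the count uses: a spanning forest has at most
  \<open>card V - 1\<close> edges and leaves at least one face, and each further edge closes a cycle
  and so adds a face.\<close>

lemma many_faces:
  assumes "r \<in> V" "\<And>v. v \<in> V \<Longrightarrow> con E r v"
  shows "card E + 2 \<le> card (faces E) + card V"
proof -
  obtain B where B: "span_forest B" using ex_span_forest by blast
  have BE: "B \<subseteq> E" using span_forest_sub[OF B] .
  have "card G + 1 \<le> card (faces (B \<union> G))" if "G \<subseteq> E - B" for G
  proof -
    have "finite G" using that finE by (meson Diff_subset finite_subset)
    then show ?thesis using that
    proof (induction G rule: finite_induct)
      case empty
      show ?case using faces_nonempty[OF BE] by simp
    next
      case (insert e G)
      obtain a b where ab: "e = {a, b}" using edge_obtain insert.prems by blast
      have "con B a b" using span_forest_con[OF B] ab insert.prems con_edge by fastforce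
      then have "con (B \<union> G) a b" by (rule con_mono) auto
      then have "card (faces (insert e (B \<union> G))) = card (faces (B \<union> G)) + 1"
        unfolding ab by (intro card_faces_cycle_edge) (use ab insert BE in auto)
      then show ?case using insert by simp
    qed
  qed
  from this[of "E - B"] have "card (E - B) + 1 \<le> card (faces E)" using BE by (simp add: Un_absorb1)
  moreover have "card E = card B + card (E - B)"
    using BE finE by (metis card_Diff_subset card_mono finite_subset le_add_diff_inverse)
  ultimately show ?thesis using card_span_forest[OF B assms] by simp
qed

text \<open>Touching the closure in one point is enough, so every frontier point of a face that is
  not a vertex yields an incident edge.\<close>

definition incident :: "complex set \<Rightarrow> 'a set \<Rightarrow> bool" where
  "incident X e \<longleftrightarrow> open_arc e \<inter> closure X \<noteq> {}"

text \<open>Without \<open>e\<close>, its open arc lies in one face, which is open and so misses the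
  closures of the others. Drawing \<open>e\<close> replaces just this face, by at most two.\<close>

lemma card_incident_faces:
  assumes "e \<in> E"
  shows "card {X \<in> faces E. incident X e} \<le> 2"
proof -
  have F: "E - {e} \<subseteq> E" "e \<notin> E - {e}" "insert e (E - {e}) = E" using assms by auto
  from add_edge[OF F(1) assms F(2)] obtain U T where
      U: "U \<in> faces (E - {e})" "open_arc e \<subseteq> U" "finite T" "card T \<le> 2"
    and fc: "faces E = (faces (E - {e}) - {U}) \<union> T"
    unfolding F(3) by blast
  have oU: "open U" using open_components U(1) closed_drawing[OF F(1)] by blast
  have "\<not> incident X e" if "X \<in> faces (E - {e}) - {U}" for X
  proof -
    have "U \<inter> X = {}" using components_nonoverlap[of U _ X] that U(1) by auto
    then have "U \<inter> closure X = {}" using open_Int_closure_eq_empty[OF oU] by simp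
    then show ?thesis using U(2) by (auto simp: incident_def)
  qed
  then have "{X \<in> faces E. incident X e} \<subseteq> T" using fc by auto
  then show ?thesis using card_mono[OF U(3)] U(4) le_trans by blast
qed

text \<open>The first assumption is the girth condition: an edge that closes a cycle with edges of
  \<open>F\<close> needs at least \<open>k - 1\<close> of them. With fewer than \<open>k\<close>
  edges in all, each edge is a bridge when it is added.\<close>

lemma few_edges_one_face:
  assumes g: "\<And>F a b. F \<subseteq> E \<Longrightarrow> {a, b} \<in> E \<Longrightarrow> {a, b} \<notin> F \<Longrightarrow> con F a b \<Longrightarrow> k \<le> card F + 1"
    and F: "F \<subseteq> E" "card F < k"
  shows "card (faces F) \<le> 1"
proof -
  have "finite F" using F finE finite_subset by auto
  then show ?thesis using F
  proof (induction F rule: finite_induct)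
    case (insert e F)
    obtain a b where ab: "e = {a, b}" using edge_obtain insert.prems by blast
    have "\<not> con F a b" using g[of F a b] ab insert by auto
    then have "card (faces (insert e F)) \<le> card (faces F)"
      unfolding ab by (intro card_faces_bridge_edge) (use ab insert in auto)
    then show ?case using insert by simp
  qed (simp add: faces_empty)
qed

text \<open>If a face had fewer incident edges, these would form a forest, whose complement is connected.\<close>

lemma face_boundary:
  assumes g: "\<And>F a b. F \<subseteq> E \<Longrightarrow> {a, b} \<in> E \<Longrightarrow> {a, b} \<notin> F \<Longrightarrow> con F a b \<Longrightarrow> k \<le> card F + 1"
    and two: "2 \<le> card (faces E)" and X: "X \<in> faces E"
  shows "k \<le> card {e\<in>E. incident X e}"
proof (rule ccontr)
  assume no: "\<not> ?thesis"
  define F where "F = {e\<in>E. incident X e}"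
  have FE: "F \<subseteq> E" by (auto simp: F_def)
  have one: "card (faces F) \<le> 1"
    by (rule few_edges_one_face[OF g FE]) (use no in \<open>auto simp: F_def\<close>)
  then have cF: "connected (- drawing F)"
  proof -
    have "card (faces F) = 1" using one faces_nonempty[OF FE] by simp
    then obtain C where "faces F = {C}" using card_1_singletonE by blast
    then have "- drawing F = C" "connected C"
      using Union_components[of "- drawing F"] in_components_connected by auto
    then show ?thesis by simp
  qed
  have Xsub: "X \<subseteq> - drawing E" "X \<noteq> {}"
    using X in_components_subset in_components_nonempty by auto
  have sub: "- drawing E \<subseteq> - drawing F" using FE by (auto simp: drawing_def)
  have fr: "- drawing F \<inter> frontier X = {}"
  proof (rule ccontr)
    assume "- drawing F \<inter> frontier X \<noteq> {}"
    then obtain q where q: "q \<notin> drawing F" "q \<in> frontier X" by auto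
    have "q \<in> drawing E"
      using frontier_of_components_closed_complement[OF closed_drawing X] q by auto
    then obtain e where e: "e \<in> E" "q \<in> path_image (\<gamma> e)" "q \<notin> p ` V"
      using q(1) by (auto simp: drawing_def)
    then have "q \<in> open_arc e" using edge[OF e(1)] by (auto simp: open_arc_def)
    then have "incident X e" using q(2) by (auto simp: incident_def frontier_def)
    then have "e \<in> F" using e by (simp add: F_def)
    then show False using q(1) e by (auto simp: drawing_def)
  qed
  have "- drawing F \<inter> X \<noteq> {}" using Xsub sub by blast
  \<comment> \<open>The connected complement of \<open>drawing F\<close> meets \<open>X\<close> but
    not its frontier, so it is contained in \<open>X\<close>. Then no edge can lie outside
    \<open>F\<close>, and there is only one face.\<close>
  with connected_Int_frontier[OF cF this] fr have eq: "- drawing F \<subseteq> X" by blast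
  have "F = E"
  proof (rule ccontr)
    assume "F \<noteq> E"
    then obtain e where e: "e \<in> E" "e \<notin> F" using FE by auto
    have "open_arc e \<subseteq> X" using open_arc_disjoint[OF FE e] eq by blast
    moreover have "open_arc e \<subseteq> drawing E" using e by (auto simp: open_arc_def drawing_def)
    ultimately show False using open_arc_nonempty[OF e(1)] Xsub by blast
  qed
  then show False using one two by simp
qed

text \<open>Let f, e, n count faces, edges and vertices. With two or more faces, counting incidences
  gives 3 f \<le> e, and with e + 2 \<le> f + n even 2 e + 6 \<le> 3 n follows. With one face, e
  \<le> n - 1; the constant 4 comes from this case, where a single edge attains it.\<close>

lemma sparse:
  assumes g: "\<And>F a b. F \<subseteq> E \<Longrightarrow> {a, b} \<in> E \<Longrightarrow> {a, b} \<notin> F \<Longrightarrow> con F a b \<Longrightarrow> 6 \<le> card F + 1"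
    and V: "2 \<le> card V" and con: "\<And>u v. u \<in> V \<Longrightarrow> v \<in> V \<Longrightarrow> con E u v"
  shows "2 * card E + 4 \<le> 3 * card V"
proof -
  obtain r where r: "r \<in> V" using V by fastforce
  note f = many_faces[OF r con[OF r]]
  show ?thesis
  proof (cases "2 \<le> card (faces E)")
    case False
    then show ?thesis using f V by linarith
  next
    case True
    have "6 * card (faces E) \<le> (\<Sum>X\<in>faces E. card {e\<in>E. incident X e})"
      using sum_bounded_below[of "faces E" 6 "\<lambda>X. card {e\<in>E. incident X e}"]
        face_boundary[OF g True] by (simp add: mult.commute)
    also have "\<dots> = (\<Sum>X\<in>faces E. \<Sum>e\<in>E. if incident X e then 1 else 0)"
      using finE by (simp add: sum.If_cases Int_def)
    also have "\<dots> = (\<Sum>e\<in>E. \<Sum>X\<in>faces E. if incident X e then 1 else 0)"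
      by (rule sum.swap)
    also have "\<dots> = (\<Sum>e\<in>E. card {X\<in>faces E. incident X e})"
      using finite_faces[of E] by (simp add: sum.If_cases Int_def)
    also have "\<dots> \<le> 2 * card E"
      using sum_bounded_above[of E "\<lambda>e. card {X\<in>faces E. incident X e}" 2] card_incident_faces
      by (simp add: mult.commute)
    finally show ?thesis using f by linarith
  qed
qed

end

section \<open>Colourings from a decomposition\<close>

lemma con_distinct_path:
  assumes "con F u v"
  shows "\<exists>xs. xs \<noteq> [] \<and> hd xs = u \<and> last xs = v \<and> distinct xs \<and>
    (\<forall>i. Suc i < length xs \<longrightarrow> {xs ! i, xs ! Suc i} \<in> F)"
  using assms
proof (induction rule: con_induct)
  case refl
  show ?case by (intro exI[of _ "[u]"]) auto
next
  case (step a b)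
  then obtain xs where xs: "xs \<noteq> []" "hd xs = u" "last xs = a" "distinct xs"
    "\<And>i. Suc i < length xs \<Longrightarrow> {xs ! i, xs ! Suc i} \<in> F" by auto
  show ?case
  proof (cases "b \<in> set xs")
    case True
    then obtain k where k: "k < length xs" "xs ! k = b" by (auto simp: in_set_conv_nth)
    then have "last (take (Suc k) xs) = b" by (simp add: take_Suc_conv_app_nth)
    then show ?thesis using xs k by (intro exI[of _ "take (Suc k) xs"]) auto
  next
    case False
    have "{(xs @ [b]) ! i, (xs @ [b]) ! Suc i} \<in> F" if "Suc i < length (xs @ [b])" for i
    proof (cases "Suc i = length xs")
      case True
      then have "xs ! i = a" using xs(1,3) by (metis last_conv_nth diff_Suc_1)
      then show ?thesis using True step.hyps(2) by (simp add: nth_append)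
    next
      case False
      then show ?thesis using xs(5)[of i] that by (simp add: nth_append)
    qed
    then show ?thesis using xs False by (intro exI[of _ "xs @ [b]"]) auto
  qed
qed

lemma walk_con:
  assumes "walk G xs"
  shows "con (edges G) (hd xs) (last xs)"
proof -
  have "con (edges G) (xs ! 0) (xs ! i)" if "i < length xs" for i
    using that
  proof (induction i)
    case (Suc i)
    then have "{xs ! i, xs ! Suc i} \<in> edges G" using assms by (auto simp: walk_def)
    from con_trans[OF Suc.IH con_edge[OF this]] Suc.prems show ?case by simp
  qed simp
  from this[of "length xs - 1"] show ?thesis
    using assms by (simp add: walk_def hd_conv_nth last_conv_nth)
qed

context finite_graph
begin

lemma path_walk:
  assumes "F \<subseteq> E" "xs \<noteq> []" "hd xs \<in> V" "\<forall>i. Suc i < length xs \<longrightarrow> {xs ! i, xs ! Suc i} \<in> F"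
  shows "walk (V, F) xs"
proof -
  have "xs ! i \<in> V" if "i < length xs" for i
  proof (cases i)
    case 0
    then show ?thesis using assms(2,3) by (simp add: hd_conv_nth)
  next
    case (Suc j)
    then have "{xs ! j, xs ! i} \<in> E" using assms(1,4) that by auto
    then show ?thesis using edgeD by blast
  qed
  then have "set xs \<subseteq> V" by (auto simp: in_set_conv_nth)
  then show ?thesis using assms by (simp add: walk_def)
qed

lemma girth_cycle_edges:
  assumes girth: "enat k \<le> girth (V, E)"
    and F: "F \<subseteq> E" and e: "{a, b} \<in> E" "{a, b} \<notin> F" and con: "con F a b"
  shows "k \<le> card F + 1"
proof -
  obtain xs where xs: "xs \<noteq> []" "hd xs = a" "last xs = b" "distinct xs"
    "\<forall>i. Suc i < length xs \<longrightarrow> {xs ! i, xs ! Suc i} \<in> F"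
    using con_distinct_path[OF con] by blast
  have ab: "a \<in> V" "b \<in> V" "a \<noteq> b" using edgeD[OF e(1)] by auto
  \<comment> \<open>A path of one edge would be \<open>{a, b}\<close> itself, which is not in
    \<open>F\<close>.\<close>
  have len: "3 \<le> length xs"
  proof (rule ccontr)
    assume "\<not> ?thesis"
    moreover have "length xs \<noteq> 0" using xs(1) by simp
    ultimately consider "length xs = 1" | "length xs = 2" by linarith
    then show False
    proof cases
      case 1
      then show ?thesis using xs(2,3) ab(3) by (auto simp: length_Suc_conv)
    next
      case 2
      then have "xs = [a, b]" using xs(2,3) by (auto simp: numeral_2_eq_2 length_Suc_conv)
      then show ?thesis using xs(5) e(2) by auto
    qed
  qed
  have "walk (V, E) xs" by (rule path_walk) (use xs ab F in auto)
  then have "cycle (V, E) xs"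
    using xs len e(1) by (simp add: cycle_def insert_commute)
  then have "girth (V, E) \<le> enat (length xs)" unfolding girth_def by (auto intro: INF_lower)
  then have k: "k \<le> length xs" using girth by (metis enat_ord_simps(1) order_trans)
  \<comment> \<open>The vertices are distinct, hence so are the \<open>length xs - 1\<close> edges
    of the path; the closing edge accounts for the \<open>+ 1\<close>.\<close>
  have "card {..<length xs - 1} \<le> card F"
  proof (rule card_inj_on_le)
    show "inj_on (\<lambda>i. {xs ! i, xs ! Suc i}) {..<length xs - 1}"
    proof (rule inj_onI)
      fix i j assume ij: "i \<in> {..<length xs - 1}" "j \<in> {..<length xs - 1}"
        "{xs ! i, xs ! Suc i} = {xs ! j, xs ! Suc j}"
      then have l: "i < length xs" "Suc i < length xs" "j < length xs" "Suc j < length xs" by auto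
      from ij(3) have "xs ! i = xs ! j \<or> xs ! i = xs ! Suc j \<and> xs ! Suc i = xs ! j"
        by (auto simp: doubleton_eq_iff)
      then have "i = j \<or> i = Suc j \<and> Suc i = j"
        using l nth_eq_iff_index_eq[OF xs(4)] by blast
      then show "i = j" by linarith
    qed
    show "(\<lambda>i. {xs ! i, xs ! Suc i}) ` {..<length xs - 1} \<subseteq> F" using xs(5) by auto
  qed (use F finE finite_subset in blast)
  then show ?thesis using k by simp
qed

text \<open>Prescribing the colour of one vertex makes the induction work: the forest without
  \<open>e\<close> is coloured once with \<open>u\<close> prescribed and once with \<open>y\<close>
  given a colour unlike that of \<open>x\<close>. The second colouring is used on the component of
  \<open>y\<close> only.\<close>

lemma forest_list_coloring:
  fixes L :: "'a \<Rightarrow> int set"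
  assumes "finite B" "B \<subseteq> E" "\<And>x y. {x, y} \<in> B \<Longrightarrow> \<not> con (B - {{x, y}}) x y"
    and L: "\<forall>v\<in>V. card (L v) = 2" and "u \<in> V" "k \<in> L u"
  shows "\<exists>c. c u = k \<and> (\<forall>v\<in>V. c v \<in> L v) \<and> (\<forall>x y. {x, y} \<in> B \<longrightarrow> c x \<noteq> c y)"
  using assms(1-3,5,6)
proof (induction B arbitrary: u k rule: finite_induct)
  case empty
  have "\<exists>j. j \<in> L v" if "v \<in> V" for v
    using L that by (metis card.empty ex_in_conv zero_neq_numeral)
  then have "(SOME j. j \<in> L v) \<in> L v" if "v \<in> V" for v
    using that someI_ex[of "\<lambda>j. j \<in> L v"] by blast
  then show ?case
    using empty.prems by (intro exI[of _ "\<lambda>v. if v = u then k else SOME j. j \<in> L v"]) auto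
next
  case (insert e B)
  obtain a b where ab: "e = {a, b}" using edge_obtain insert.prems(1) by blast
  have nab: "\<not> con B a b"
  proof -
    have "insert e B - {{a, b}} = B" using ab insert.hyps(2) by auto
    then show ?thesis using insert.prems(2)[of a b] ab by simp
  qed
  \<comment> \<open>The end called \<open>y\<close> is chosen outside the component of
    \<open>u\<close>, so that recolouring leaves the prescribed colour alone.\<close>
  have "\<not> con B u b \<or> \<not> con B u a"
    using nab con_trans[OF con_sym, of B u a b] by blast
  then obtain x y where xy: "e = {x, y}" "\<not> con B u y" "\<not> con B x y"
  proof
    assume "\<not> con B u b"
    then show thesis using that[of a b] ab nab by blast
  next
    assume n: "\<not> con B u a"
    have "e = {b, a}" using ab by (simp add: insert_commute)
    moreover have "\<not> con B b a" using nab con_commute[of B b a] by simp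
    ultimately show thesis using that[of b a] n by blast
  qed
  have V: "x \<in> V" "y \<in> V" using edgeD[of x y] xy insert.prems(1) by auto
  have br: "\<not> con (B - {{p, q}}) p q" if "{p, q} \<in> B" for p q
  proof
    assume "con (B - {{p, q}}) p q"
    then have "con (insert e B - {{p, q}}) p q" by (rule con_mono) auto
    then show False using insert.prems(2)[of p q] that by simp
  qed
  have BE: "B \<subseteq> E" using insert.prems(1) by auto
  obtain c1 where c1: "c1 u = k" "\<forall>v\<in>V. c1 v \<in> L v" "\<forall>x y. {x, y} \<in> B \<longrightarrow> c1 x \<noteq> c1 y"
    using insert.IH[OF BE br insert.prems(3,4)] by blast
  obtain k' where k': "k' \<in> L y" "k' \<noteq> c1 x"
  proof -
    have "card (L y) = 2" using L V by simp
    then obtain i j where "L y = {i, j}" "i \<noteq> j" by (auto simp: card_2_iff)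
    then show thesis using that[of i] that[of j] by auto
  qed
  obtain c2 where c2: "c2 y = k'" "\<forall>v\<in>V. c2 v \<in> L v" "\<forall>x y. {x, y} \<in> B \<longrightarrow> c2 x \<noteq> c2 y"
    using insert.IH[OF BE br V(2) k'(1)] by blast
  define c where "c v = (if con B y v then c2 v else c1 v)" for v
  have yx: "\<not> con B y x" "\<not> con B y u" using xy(2,3) con_commute[of B y] by simp_all
  then have cxy: "c x \<noteq> c y" using k' c2(1) by (simp add: c_def)
  have "c p \<noteq> c q" if pq: "{p, q} \<in> insert e B" for p q
  proof (cases "{p, q} = e")
    case True
    then show ?thesis using cxy xy(1) by (auto simp: doubleton_eq_iff)
  next
    case False
    then have B: "{p, q} \<in> B" using pq by auto
    then have "con B y p \<longleftrightarrow> con B y q"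
      using comp_step[OF B, of y] by (simp add: conn_comp_def)
    then show ?thesis using B c1(3) c2(3) by (auto simp: c_def)
  qed
  moreover have "c u = k" "\<forall>v\<in>V. c v \<in> L v" using yx c1 c2 by (auto simp: c_def)
  ultimately show ?case by blast
qed

text \<open>A connected graph has at most one more vertex than edges. Two edges must therefore share
  a vertex, as disjoint ones would need four.\<close>

lemma small_component_path:
  assumes "F \<subseteq> E" "u \<in> V" "comp_size F u \<le> 2"
  shows "is_path_graph (conn_comp F u, comp_edges F u) (comp_size F u)"
proof -
  define X where "X = conn_comp F u"
  define A where "A = comp_edges F u"
  have finF: "finite F" using assms(1) finE finite_subset by auto
  have "X \<subseteq> V" using con_in_V[OF _ assms(1,2)] by (auto simp: X_def conn_comp_def)
  then have finX: "finite X" using finV finite_subset by auto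
  have cX: "card X \<le> card A + 1"
    using card_comp_le[OF finF finX[unfolded X_def]] by (simp add: X_def A_def comp_size_def)
  have A: "e \<subseteq> X" "card e = 2" if "e \<in> A" for e
    using that assms(1) edge by (auto simp: A_def X_def comp_edges_def)
  have finA: "finite A" using finF by (simp add: A_def)
  have uX: "u \<in> X" by (simp add: X_def)
  have "is_path_graph (X, A) (card A)"
  proof -
    have "card A \<le> 2" using assms(3) by (simp add: A_def comp_size_def)
    then consider "card A = 0" | "card A = 1" | "card A = 2" by linarith
    then show ?thesis
    proof cases
      case 1
      then have "A = {}" "X = {u}"
        using finA cX uX finX by (auto simp: card_le_Suc0_iff_eq)
      then show ?thesis unfolding is_path_graph_def by (intro exI[of _ "[u]"]) auto
    next
      case 2
      then obtain e where e: "A = {e}" by (rule card_1_singletonE)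
      then obtain a b where ab: "e = {a, b}" "a \<noteq> b" using A(2) by (auto simp: card_2_iff)
      have "e = X" by (rule card_seteq[OF finX]) (use A e cX 2 in auto)
      then show ?thesis using e ab 2 unfolding is_path_graph_def
        by (intro exI[of _ "[a, b]"]) auto
    next
      case 3
      then obtain e f where ef: "A = {e, f}" "e \<noteq> f" by (auto simp: card_2_iff)
      have e: "e \<subseteq> X" "card e = 2" and f: "f \<subseteq> X" "card f = 2" using A ef(1) by auto
      have fin: "finite e" "finite f" using finite_subset[OF e(1) finX] finite_subset[OF f(1) finX] by auto
      have "e \<inter> f \<noteq> {}"
      proof
        assume "e \<inter> f = {}"
        then have "card (e \<union> f) = 4" using e f fin by (simp add: card_Un_disjoint)
        moreover have "card (e \<union> f) \<le> card X" using e f by (intro card_mono[OF finX]) simp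
        ultimately show False using cX 3 by simp
      qed
      then obtain b where b: "b \<in> e" "b \<in> f" by auto
      obtain a where a: "e = {a, b}" "a \<noteq> b" using e(2) b(1) by (auto simp: card_2_iff)
      obtain d where d: "f = {b, d}" "b \<noteq> d" using f(2) b(2) by (auto simp: card_2_iff)
      have ad: "a \<noteq> d" using a d ef(2) by (auto simp: insert_commute)
      have X3: "{a, b, d} = X"
        by (rule card_seteq[OF finX]) (use e f a d ad cX 3 in auto)
      have E3: "{{[a, b, d] ! i, [a, b, d] ! Suc i} |i. i < 2} = {{a, b}, {b, d}}"
      proof -
        have "{h i |i. i < (2::nat)} = {h 0, h 1}" for h :: "nat \<Rightarrow> 'a set"
          by (auto simp: less_2_cases_iff)
        then show ?thesis by simp
      qed
      have "A = {{a, b}, {b, d}}" using ef(1) a(1) d(1) by simp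
      then show ?thesis unfolding is_path_graph_def 3
        by (intro exI[of _ "[a, b, d]"] conjI) (use a(2) d(2) ad X3 E3 in simp_all)
    qed
  qed
  then show ?thesis by (simp add: X_def A_def comp_size_def)
qed

text \<open>A monochromatic edge is not in \<open>B\<close>, so a component of a colour class lies
  within a component of \<open>E - B\<close> and has at most two edges.\<close>

lemma monochromatic_component_path:
  assumes c: "\<And>x y. {x, y} \<in> B \<Longrightarrow> c x \<noteq> c y" and small: "\<And>v. comp_size (E - B) v \<le> 2"
    and H: "H \<in> monochromatic_components (V, E) c"
  shows "\<exists>n\<le>2. is_path_graph H n"
proof -
  from H obtain k u where
    u: "u \<in> verts (induced (V, E) {v. c v = k})" and
    H: "H = induced (induced (V, E) {v. c v = k}) {v. reachable (induced (V, E) {v. c v = k}) u v}"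
    by (auto simp: monochromatic_components_def graph_components_def)
  define S where "S = {v. c v = k}"
  define F where "F = {e\<in>E. e \<subseteq> S}"
  have G': "induced (V, E) {v. c v = k} = (V \<inter> S, F)" by (simp add: induced_def S_def F_def)
  have uV: "u \<in> V" "u \<in> S" using u by (auto simp: G')
  have FE: "F \<subseteq> E" by (auto simp: F_def)
  have FR: "F \<subseteq> E - B"
  proof
    fix e assume e: "e \<in> F"
    then obtain x y where xy: "e = {x, y}" using edge_obtain FE by blast
    then have "c x = c y" using e by (auto simp: F_def S_def)
    then have "e \<notin> B" using c xy by blast
    then show "e \<in> E - B" using e FE by auto
  qed
  have KS: "conn_comp F u \<subseteq> V \<inter> S"
    by (rule comp_least) (use uV edgeD in \<open>auto simp: F_def\<close>)
  have "reachable (V \<inter> S, F) u v \<longleftrightarrow> con F u v" for v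
  proof
    assume "reachable (V \<inter> S, F) u v"
    then show "con F u v" using walk_con[of "(V \<inter> S, F)"] by (auto simp: reachable_def)
  next
    assume "con F u v"
    from con_distinct_path[OF this] obtain xs where xs: "xs \<noteq> []" "hd xs = u" "last xs = v"
      "\<forall>i. Suc i < length xs \<longrightarrow> {xs ! i, xs ! Suc i} \<in> F" by blast
    have F: "finite_graph (V \<inter> S) F"
    proof
      show "e \<subseteq> V \<inter> S \<and> card e = 2" if "e \<in> F" for e
        using that edge[of e] by (auto simp: F_def)
    qed (use finV in simp)
    have "walk (V \<inter> S, F) xs"
      by (rule finite_graph.path_walk[OF F order_refl xs(1) _ xs(4)]) (use xs(2) uV in simp)
    then show "reachable (V \<inter> S, F) u v" using xs by (auto simp: reachable_def)
  qed
  then have "H = (conn_comp F u, comp_edges F u)"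
    using KS unfolding H G' by (auto simp: induced_def conn_comp_def comp_edges_def)
  moreover have "comp_size F u \<le> 2" using comp_size_mono[OF FR, of u] small[of u] by simp
  ultimately show ?thesis using small_component_path[OF FE uV(1)] by blast
qed

end

theorem theorem1:
  fixes G :: "'a ugraph" and L :: "'a \<Rightarrow> int set"
  assumes "simple_graph G"
    and "planar_graph G"
    and "girth G \<ge> 6"
    and "\<forall>v\<in>verts G. card (L v) = 2"
  shows "\<exists>c. list_coloring G L c \<and>
    (\<forall>H\<in>monochromatic_components G c. \<exists>n\<le>14. is_path_graph H n)"
proof -
  obtain V E where G: "G = (V, E)" by (cases G)
  interpret finite_graph V E
    by standard (use assms(1) in \<open>auto simp: simple_graph_def G\<close>)
  obtain p \<gamma> where d: "plane_drawing (V, E) p \<gamma>" using assms(2) by (auto simp: planar_graph_def G)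
  have g: "enat 6 \<le> girth (V, E)" using assms(3) by (simp add: G numeral_eq_enat)
  have sparse: "2 * card {e\<in>E. e \<subseteq> H} + 4 \<le> 3 * card H"
    if H: "H \<subseteq> V" "2 \<le> card H" "\<And>u v. u \<in> H \<Longrightarrow> v \<in> H \<Longrightarrow> con {e\<in>E. e \<subseteq> H} u v" for H
  proof -
    \<comment> \<open>The drawing restricts to the induced subgraph, and the girth condition is
      inherited because its cycles are cycles of \<open>G\<close>.\<close>
    interpret sub: plane_graph H "{e\<in>E. e \<subseteq> H}" p \<gamma>
    proof
      show "finite H" using H(1) finV finite_subset by auto
      show "inj_on p H" using d H(1) inj_on_subset by (auto simp: plane_drawing_def)
      show "e \<subseteq> H \<and> card e = 2" if "e \<in> {e\<in>E. e \<subseteq> H}" for e using that edge[of e] by auto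
      show "arc (\<gamma> e)" "{pathstart (\<gamma> e), pathfinish (\<gamma> e)} = p ` e" if "e \<in> {e\<in>E. e \<subseteq> H}" for e
        using that d by (auto simp: plane_drawing_def)
      show "v \<in> e" if "e \<in> {e\<in>E. e \<subseteq> H}" "v \<in> H" "p v \<in> path_image (\<gamma> e)" for e v
        using that d H(1) by (auto simp: plane_drawing_def)
      show "path_image (\<gamma> e) \<inter> path_image (\<gamma> f) \<subseteq> p ` (e \<inter> f)"
        if "e \<in> {e\<in>E. e \<subseteq> H}" "f \<in> {e\<in>E. e \<subseteq> H}" "e \<noteq> f" for e f
        using that d by (simp add: plane_drawing_def)
    qed
    show ?thesis
    proof (rule sub.sparse[OF _ H(2,3)])
      show "6 \<le> card F + 1" if "F \<subseteq> {e\<in>E. e \<subseteq> H}" "{a, b} \<in> {e\<in>E. e \<subseteq> H}" "{a, b} \<notin> F" "con F a b" for F a b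
        using girth_cycle_edges[OF g, of F a b] that by auto
    qed
  qed
  have "\<exists>B. span_forest B \<and> (\<forall>v. comp_size (E - B) v \<le> 2)"
    by (rule sparse_decomposition) (rule sparse)
  then obtain B where B: "span_forest B" "\<And>v. comp_size (E - B) v \<le> 2" by blast
  have fB: "finite B" using span_forest_sub[OF B(1)] finE finite_subset by auto
  have "\<exists>c. (\<forall>v\<in>V. c v \<in> L v) \<and> (\<forall>x y. {x, y} \<in> B \<longrightarrow> c x \<noteq> c y)"
  \<comment> \<open>The colouring lemma starts from a vertex with a prescribed colour, which the
    empty graph lacks.\<close>
  proof (cases "V = {}")
    case True
    then have "B = {}" using span_forest_sub[OF B(1)] edge by fastforce
    then show ?thesis using True by auto
  next
    case False
    then obtain u where u: "u \<in> V" by auto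
    moreover have "card (L u) = 2" using assms(4) u by (simp add: G)
    then obtain k where "k \<in> L u" by (auto simp: card_2_iff)
    ultimately show ?thesis
      using forest_list_coloring[OF fB span_forest_sub[OF B(1)] span_forest_bridge[OF B(1)], of L u k] assms(4)
      by (auto simp: G)
  qed
  then obtain c where c: "\<forall>v\<in>V. c v \<in> L v" "\<forall>x y. {x, y} \<in> B \<longrightarrow> c x \<noteq> c y" by blast
  have "\<exists>n\<le>14. is_path_graph H n" if "H \<in> monochromatic_components G c" for H
  proof -
    have "\<exists>n\<le>2. is_path_graph H n"
      by (rule monochromatic_component_path[of B c]) (use c(2) B(2) that in \<open>auto simp: G\<close>)
    then obtain n where "n \<le> 2" "is_path_graph H n" by blast
    then show ?thesis by (intro exI[of _ n]) simp
  qed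
  then show ?thesis using c(1) by (auto simp: list_coloring_def G)
qed

end
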